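(* Assume the following. (1) There exist nonrandom functions $\widetilde M_0^{a}:\Theta_\alpha\to\mathbb R$ and $\widetilde M_0^{b}:\Theta_\beta\to\mathbb R$ and positive constants $\delta_1^a,\delta_1^b,\chi^a,\chi^b$ such that for all $K>0$: $\sup_{n}E\big[\sup_{\theta\in\Theta}\big|s_n^{-2\delta_1^a}\{s_n^2(M_n(\alpha,\beta)-M_n(\alpha_0,\beta))-\widetilde M_0^a(\alpha)\}\big|^K\big]<\infty$; $\sup_{n}E\big[\sup_{\beta\in\Theta_\beta}\big|t_n^{-2\delta_1^b}\{t_n^2(M_n(\alpha_0,\beta)-M_n(\alpha_0,\beta_0))-\widetilde M_0^b(\beta)\}\big|^K\big]<\infty$; $\widetilde M_0^a(\alpha)\ge\chi^a|\alpha-\alpha_0|^2$ for all $\alpha$ and $\widetilde M_0^b(\beta)\ge\chi^b|\beta-\beta_0|^2$ for all $\beta$. (2) There exist nonrandom matrices $C_0(\beta)\in\mathbb R^{p}\otimes\mathbb R^{p}$ ($\beta\in\Theta_\beta$) and a positive definite $C_0\in\mathbb R^q\otimes\mathbb R^q$, and constants $\delta_2^a,\delta_2^b\in(0,1/2]$, such that $\inf_\beta\lambda_{\min}(C_0(\beta))>0$ and for all $K>0$: $\sup_nE[\sup_{\beta\in\Theta_\beta}(s_n^{-2\delta_2^a}|s_n^2\partial_\alpha^2M_n(\alpha_0,\beta)-C_0(\beta)|)^K]<\infty$; $\sup_nE[(t_n^{-2\delta_2^b}|t_n^2\partial_\beta^2M_n(\alpha_0,\beta_0)-C_0|)^K]<\infty$;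 $\sup_nE[\sup_{\alpha\in\Theta_\alpha}|s_nt_n^{2(1-\delta_2^b)}\partial_\alpha\partial_\beta^2M_n(\alpha,\beta_0)|^K]<\infty$. (3) For all $K>0$: $\sup_nE[\sup_{\beta\in\Theta_\beta}|s_n\partial_\alpha M_n(\alpha_0,\beta)|^K]<\infty$, $\sup_nE[|t_n\partial_\beta M_n(\alpha_0,\beta_0)|^K]<\infty$, $\sup_nE[\sup_{\theta\in\Theta}|s_n^2\partial_\alpha^3M_n(\theta)|^K]<\infty$, $\sup_nE[\sup_{\theta\in\Theta}|t_n^2\partial_\beta^3M_n(\theta)|^K]<\infty$, $\sup_nE[\sup_{\alpha\in\Theta_\alpha}|s_nt_n\partial_\alpha\partial_\beta M_n(\alpha,\beta_0)|^K]<\infty$. (4) There exist constants $\nu^a,\nu^b\in(0,1/2)$ such that for any $K>0$: $\sup_nE[\sup_{\alpha\in\Theta_\alpha}(s_n^{1+2\nu^a}\overline R_n^a(\alpha))^K]<\infty$, $\sup_nE[\sup_{\beta\in\Theta_\beta}(t_n^{1+2\nu^b}\overline R_n^b(\beta))^K]<\infty$, $\sup_n\max_{k''}E[|s_n\lambda_{n,k''}^{a\ast}|^K]<\infty$, $\sup_n\max_{l''}E[|t_n\lambda_{n,l''}^{b\ast}|^K]<\infty$. Let $\hat u_n=s_n^{-1}(\hat\alpha_n-\alpha_0)$, $\hat v_n=t_n^{-1}(\hat\beta_n-\beta_0)$, $\hat w_n=(\hat u_n,\hat v_n)$. Then for every $L>0$, $$\sup_{r>0}\sup_{n}r^LP(|\hat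 w_n|\ge r)<\infty .$$ If in addition $(\hat u_n^\circ,\hat u_n^\ast,\hat v_n^\circ,\hat v_n^\ast)$ converges in law to some random vector $(\hat u_0^\circ,\hat u_0^\ast,\hat v_0^\circ,\hat v_0^\ast)$, then $$E[f(\hat u_n,\hat v_n)]\to E[f(\hat u_0^\circ,\hat u_0^\ast,\hat v_0^\circ,\hat v_0^\ast)]$$ for every continuous $f:\mathbb R^{p+q}\to\mathbb R$ of at most polynomial growth.
   Context: All random objects live on a probability space $(\Omega,\mathcal F,P)$. The parameter is $\theta=(\alpha,\beta)\in\Theta=\Theta_\alpha\times\Theta_\beta\subset\mathbb R^p\times\mathbb R^q$, $\Theta$ a bounded convex domain (open set), and $\theta_0=(\alpha_0,\beta_0)\in\Theta$ is fixed. Coordinates are split as $\alpha=(\alpha^\circ,\alpha^\ast)\in\mathbb R^{p^\circ}\times\mathbb R^{p^\ast}$, $\beta=(\beta^\circ,\beta^\ast)\in\mathbb R^{q^\circ}\times\mathbb R^{q^\ast}$ ($p^\circ,p^\ast,q^\circ,q^\ast\ge1$), where $\alpha_0^\circ=0$, $\beta_0^\circ=0$ and every entry of $\alpha_0^\ast$ and of $\beta_0^\ast$ is nonzero; the same splitting is used for $\hat u_n=(\hat u_n^\circ,\hat u_n^\ast)$ and $\hat v_n=(\hat v_n^\circ,\hat v_n^\ast)$. $(s_n),(t_n)$ are positive nonrandom sequences tending to $0$ with $s_n=o(t_n)$. Given a random function $M_n$ of $\theta$ (a.s. three times continuously differentiable; functions of $\theta$ are understood to be defined on $\overline\Theta$),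 put $\mathbb H_n(\theta)=M_n(\alpha,\beta)+\overline R_n^a(\alpha)+\overline R_n^b(\beta)$ with $\overline R_n^a(\alpha)=\sum_{k'=1}^{p^\circ}\lambda_{n,k'}^{a\circ}R^a(\alpha_{k'}^\circ)+\sum_{k''=1}^{p^\ast}\lambda_{n,k''}^{a\ast}R^a(\alpha_{k''}^\ast)$ and $\overline R_n^b(\beta)=\sum_{l'=1}^{q^\circ}\lambda_{n,l'}^{b\circ}R^b(\beta_{l'}^\circ)+\sum_{l''=1}^{q^\ast}\lambda_{n,l''}^{b\ast}R^b(\beta_{l''}^\ast)$. The $\lambda$'s are non-negative random variables; $R^a,R^b:\mathbb R\to[0,\infty)$ are nonrandom with $R^a(0)=R^b(0)=0$, and for all $a_0,b_0\ne0$ and $k>0$ there is $C=C(a_0,b_0,k)>0$ with $|R^a(a')-R^a(a_0)|+|R^b(b')-R^b(b_0)|\le C(|a'-a_0|+|b'-b_0|)$ whenever $|a'|\vee|b'|\le k$. The regularized estimator $\hat\theta_n=(\hat\alpha_n,\hat\beta_n)$ is any element (assumed to exist) of $\operatorname{argmin}_{\theta\in\overline\Theta}\mathbb H_n(\theta)$. $\lambda_{\min}(A)$ is the smallest eigenvalue of a symmetric matrix $A$. *)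

theory Defs
  imports "HOL-Probability.Probability"
begin

text \<open>
  The parameter splits as \<open>\<alpha> = (\<alpha>\<degree>, \<alpha>*)\<close> with \<open>\<alpha> :: real ^ ('po + 'ps)\<close>: the coordinates of
  \<open>\<alpha>\<degree>\<close> are \<open>\<alpha> $ Inl k'\<close>, those of \<open>\<alpha>*\<close> are \<open>\<alpha> $ Inr k''\<close>; likewise for \<open>\<beta>\<close>.
  The norm of a pair, of a matrix and of a three-way array below is the Euclidean one.
\<close>

definition dir_deriv :: "('a::euclidean_space \<Rightarrow> real) \<Rightarrow> 'a \<Rightarrow> 'a \<Rightarrow> real" where
  "dir_deriv f v x = frechet_derivative f (at x) v"

text \<open>Class \<open>C\<^sup>k\<close>, meant for open \<open>S\<close>.\<close>

fun Ck_on :: "nat \<Rightarrow> 'a::euclidean_space set \<Rightarrow> ('a \<Rightarrow> real) \<Rightarrow> bool" where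
  "Ck_on 0 S f \<longleftrightarrow> continuous_on S f"
| "Ck_on (Suc k) S f \<longleftrightarrow> (\<forall>x\<in>S. f differentiable (at x)) \<and> (\<forall>v. Ck_on k S (dir_deriv f v))"

definition Da :: "((real^'p) \<times> (real^'q) \<Rightarrow> real) \<Rightarrow> 'p \<Rightarrow> (real^'p) \<times> (real^'q) \<Rightarrow> real" where
  "Da f i = dir_deriv f (axis i 1, 0)"

definition Db :: "((real^'p) \<times> (real^'q) \<Rightarrow> real) \<Rightarrow> 'q \<Rightarrow> (real^'p) \<times> (real^'q) \<Rightarrow> real" where
  "Db f j = dir_deriv f (0, axis j 1)"

definition D_a :: "((real^'p) \<times> (real^'q) \<Rightarrow> real) \<Rightarrow> (real^'p) \<times> (real^'q) \<Rightarrow> real^'p" where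
  "D_a f x = (\<chi> i. Da f i x)"

definition D_b :: "((real^'p) \<times> (real^'q) \<Rightarrow> real) \<Rightarrow> (real^'p) \<times> (real^'q) \<Rightarrow> real^'q" where
  "D_b f x = (\<chi> j. Db f j x)"

definition D_aa :: "((real^'p) \<times> (real^'q) \<Rightarrow> real) \<Rightarrow> (real^'p) \<times> (real^'q) \<Rightarrow> real^'p^'p" where
  "D_aa f x = (\<chi> i j. Da (Da f j) i x)"

definition D_bb :: "((real^'p) \<times> (real^'q) \<Rightarrow> real) \<Rightarrow> (real^'p) \<times> (real^'q) \<Rightarrow> real^'q^'q" where
  "D_bb f x = (\<chi> i j. Db (Db f j) i x)"

definition D_ab :: "((real^'p) \<times> (real^'q) \<Rightarrow> real) \<Rightarrow> (real^'p) \<times> (real^'q) \<Rightarrow> real^'q^'p" where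
  "D_ab f x = (\<chi> i j. Da (Db f j) i x)"

definition D_aaa :: "((real^'p) \<times> (real^'q) \<Rightarrow> real) \<Rightarrow> (real^'p) \<times> (real^'q) \<Rightarrow> real^'p^'p^'p" where
  "D_aaa f x = (\<chi> i j k. Da (Da (Da f k) j) i x)"

definition D_bbb :: "((real^'p) \<times> (real^'q) \<Rightarrow> real) \<Rightarrow> (real^'p) \<times> (real^'q) \<Rightarrow> real^'q^'q^'q" where
  "D_bbb f x = (\<chi> i j k. Db (Db (Db f k) j) i x)"

definition D_abb :: "((real^'p) \<times> (real^'q) \<Rightarrow> real) \<Rightarrow> (real^'p) \<times> (real^'q) \<Rightarrow> real^'q^'q^'p" where
  "D_abb f x = (\<chi> i j k. Da (Db (Db f k) j) i x)"

definition symmetric_matrix :: "real^'n^'n \<Rightarrow> bool" where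
  "symmetric_matrix A \<longleftrightarrow> transpose A = A"

definition positive_definite :: "real^'n^'n \<Rightarrow> bool" where
  "positive_definite A \<longleftrightarrow> symmetric_matrix A \<and> (\<forall>v. v \<noteq> 0 \<longrightarrow> v \<bullet> (A *v v) > 0)"

text \<open>Meaningful for symmetric \<open>A\<close>, whose set of (real) eigenvalues is finite and nonempty.\<close>

definition lambda_min :: "real^'n^'n \<Rightarrow> real" where
  "lambda_min A = Min {l. \<exists>v. v \<noteq> 0 \<and> A *v v = l *\<^sub>R v}"

text \<open>
  \<open>\<forall>K > 0. sup\<^sub>n E[sup\<^sub>x\<^sub>\<in>\<^sub>S |X\<^sub>n(x)|\<^sup>K] < \<infinity>\<close>, computed in \<open>[0, \<infinity>]\<close>. The power sits inside the
  inner supremum, which is the same because \<open>y \<mapsto> y\<^sup>K\<close> is continuous and increasing.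
\<close>

definition moments_bounded ::
  "'w measure \<Rightarrow> 'x set \<Rightarrow> (nat \<Rightarrow> 'w \<Rightarrow> 'x \<Rightarrow> 'v::real_normed_vector) \<Rightarrow> bool" where
  "moments_bounded P S X \<longleftrightarrow>
     (\<forall>K::real. K > 0 \<longrightarrow>
        (SUP n. \<integral>\<^sup>+\<omega>. (SUP x\<in>S. ennreal (norm (X n \<omega> x) powr K)) \<partial>P) < \<infinity>)"

definition penalty ::
  "(real \<Rightarrow> real) \<Rightarrow> ('m::finite \<Rightarrow> real) \<Rightarrow> ('k::finite \<Rightarrow> real) \<Rightarrow> real^('m + 'k) \<Rightarrow> real" where
  "penalty R lo ls x = (\<Sum>i\<in>UNIV. lo i * R (x $ Inl i)) + (\<Sum>j\<in>UNIV. ls j * R (x $ Inr j))"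

definition conv_in_law ::
  "'w measure \<Rightarrow> (nat \<Rightarrow> 'w \<Rightarrow> 'x::topological_space) \<Rightarrow> 'z measure \<Rightarrow> ('z \<Rightarrow> 'x) \<Rightarrow> bool" where
  "conv_in_law P X Q Y \<longleftrightarrow>
     (\<forall>g::'x \<Rightarrow> real. continuous_on UNIV g \<longrightarrow> bounded (range g) \<longrightarrow>
        (\<lambda>n. \<integral>\<omega>. g (X n \<omega>) \<partial>P) \<longlonglongrightarrow> (\<integral>z. g (Y z) \<partial>Q))"

definition poly_growth :: "('x::real_normed_vector \<Rightarrow> real) \<Rightarrow> bool" where
  "poly_growth f \<longleftrightarrow> (\<exists>(C::real) (k::nat). \<forall>x. \<bar>f x\<bar> \<le> C * (1 + norm x) ^ k)"

end

(*
  Since the penalty is nonnegative, vanishes at zero coordinates and is Lipschitz at the nonzero ones,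
  its decrease away from the true value is at most Z |alpha - alpha0| / s_n (and likewise for beta),
  where Z has bounded moments of all orders. Comparing the estimator with (alpha0, betahat) bounds
  M_n(alphahat, betahat) - M_n(alpha0, betahat) from above by this decrease. Assumption (1) turns this
  into the rough estimate |alphahat - alpha0| <= C Z s_n^eps; a third order Taylor expansion at alpha0
  then gives |u_n| <= C Z, except when s_n^eps Z^2 is not small, in which case 1 / s_n, and hence |u_n|,
  is itself at most a power of Z. Comparing next with (alpha0, beta0) and feeding in the bound on u_n
  gives an inequality of the same kind for betahat. So |w_n| is dominated by a fixed polynomial
  expression in powers of Z, and all its moments are bounded.
*)

theory Submission
  imports Defs "HOL-Real_Asymp.Real_Asymp"
begin

text \<open>The comparison with (\<open>\<alpha>0\<close>, betahat) has the same beta penalty on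
  both sides, and the control of the alpha increment is uniform in beta, so the first block can be
  treated without knowing betahat. The second comparison controls only the sum of the alpha
  increment of \<open>M\<close> at betahat and the beta increment at \<open>\<alpha>0\<close>. The
  former may be negative, so it must be bounded below; the expansion in alpha supplies this once
  alphahat - \<open>\<alpha>0\<close> is known to be of order \<open>s n\<close>.

  All estimates are inequalities at a fixed sample point with nonrandom constants. Probability
  enters through the class of nonnegative variables with uniformly bounded moments of all orders,
  which is stable under sums, products and positive powers; any polynomial loss in \<open>Z\<close>
  is therefore harmless.

  The minimizer may lie on the boundary of the parameter set, where no derivative is available, and
  the almost sure bounds are at hand only on countable dense sets. The inequalities are therefore
  first freed of everything but values of \<open>M\<close> and norms, and then carried to the
  closure by continuity of \<open>M\<close>.\<close>

section \<open>Directional derivatives and a quantitative Taylor expansion\<close>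

lemma dir_deriv_linear_combination:
  fixes f :: "'a::euclidean_space \<Rightarrow> real"
  assumes "f differentiable (at x)"
  shows "dir_deriv f (\<Sum>i\<in>A. c i *\<^sub>R e i) x = (\<Sum>i\<in>A. c i * dir_deriv f (e i) x)"
proof -
  interpret linear "frechet_derivative f (at x)"
    using assms by (rule linear_frechet_derivative)
  show ?thesis by (simp add: dir_deriv_def sum scale)
qed

lemma dir_deriv_eqI:
  assumes "(f has_derivative f') (at x)"
  shows "dir_deriv f v x = f' v"
  using frechet_derivative_at[OF assms] by (simp add: dir_deriv_def)

lemma dir_deriv_cong_open:
  fixes f :: "'a::euclidean_space \<Rightarrow> real"
  assumes "f differentiable (at x)" "open S" "x \<in> S" "\<And>y. y \<in> S \<Longrightarrow> f y = g y"
  shows "dir_deriv f v x = dir_deriv g v x"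
  unfolding dir_deriv_def using frechet_derivative_transform_within_open[OF assms(1-3)] assms(4)
  by metis

lemma dir_deriv_sum_functions:
  fixes g :: "'i \<Rightarrow> 'a::euclidean_space \<Rightarrow> real"
  assumes "\<And>i. i \<in> A \<Longrightarrow> g i differentiable (at x)"
  shows "dir_deriv (\<lambda>y. \<Sum>i\<in>A. c i * g i y) v x = (\<Sum>i\<in>A. c i * dir_deriv (g i) v x)"
proof -
  have "((\<lambda>y. \<Sum>i\<in>A. c i * g i y) has_derivative
         (\<lambda>h. \<Sum>i\<in>A. c i * frechet_derivative (g i) (at x) h)) (at x)"
    by (intro has_derivative_sum has_derivative_mult_right)
       (use assms frechet_derivative_works in blast)
  from dir_deriv_eqI[OF this] show ?thesis by (simp add: dir_deriv_def)
qed

lemma DERIV_along_line: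
  fixes f :: "'a::euclidean_space \<Rightarrow> real"
  assumes "f differentiable (at (x + r *\<^sub>R h))"
  shows "((\<lambda>r. f (x + r *\<^sub>R h)) has_real_derivative dir_deriv f h (x + r *\<^sub>R h)) (at r)"
proof -
  let ?f' = "frechet_derivative f (at (x + r *\<^sub>R h))"
  have f': "(f has_derivative ?f') (at (x + r *\<^sub>R h))"
    using assms frechet_derivative_works by blast
  have "((\<lambda>r. x + r *\<^sub>R h) has_derivative (\<lambda>k. k *\<^sub>R h)) (at r)"
    by (auto intro!: derivative_eq_intros)
  from has_derivative_compose[OF this f']
  have "((\<lambda>r. f (x + r *\<^sub>R h)) has_derivative (\<lambda>k. ?f' (k *\<^sub>R h))) (at r)" .
  moreover have "?f' (k *\<^sub>R h) = k * ?f' h" for k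
    using linear_frechet_derivative[OF assms] by (simp add: linear_cmul)
  ultimately show ?thesis
    by (simp add: has_field_derivative_def dir_deriv_def mult.commute[of _ "?f' h"])
qed

lemma Ck_on_3:
  fixes f :: "'a::euclidean_space \<Rightarrow> real"
  assumes "Ck_on 3 S f"
  shows "x \<in> S \<Longrightarrow> f differentiable (at x)"
    and "x \<in> S \<Longrightarrow> dir_deriv f d differentiable (at x)"
    and "x \<in> S \<Longrightarrow> dir_deriv (dir_deriv f d) d' differentiable (at x)"
    and "continuous_on S (dir_deriv (dir_deriv (dir_deriv f d) d') d'')"
  using assms by (auto simp: numeral_3_eq_3)

text \<open>Taylor's theorem in one variable along the segment from \<open>x\<close> to
  \<open>x + h\<close>, which convexity keeps inside \<open>S\<close>.\<close>

lemma second_order_Taylor: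
  fixes f :: "'a::euclidean_space \<Rightarrow> real"
  assumes f: "Ck_on 3 S f" and S: "convex S" and x: "x \<in> S" "x + h \<in> S"
  obtains y where "y \<in> S"
    "f (x + h) = f x + dir_deriv f h x + dir_deriv (dir_deriv f h) h x / 2
       + dir_deriv (dir_deriv (dir_deriv f h) h) h y / 6"
proof -
  \<comment> \<open>Differentiating along the line amounts to applying \<open>dir_deriv\<close> in
    the fixed direction \<open>h\<close>, so \<open>g m\<close> is the \<open>m\<close>-th
    derivative of \<open>g 0\<close>.\<close>
  define g where "g m = (\<lambda>r. (((\<lambda>k. dir_deriv k h) ^^ m) f) (x + r *\<^sub>R h))" for m :: nat
  have line: "x + r *\<^sub>R h \<in> S" if "0 \<le> r" "r \<le> 1" for r :: real
  proof -
    have "(1 - r) *\<^sub>R x + r *\<^sub>R (x + h) \<in> S"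
      by (rule convexD) (use S x that in auto)
    then show ?thesis by (simp add: algebra_simps)
  qed
  have "((\<lambda>k. dir_deriv k h) ^^ m) f differentiable (at y)" if "m < 3" "y \<in> S" for m y
    using that Ck_on_3[OF f] by (auto simp: numeral_3_eq_3 less_Suc_eq)
  then have "\<forall>m r. m < 3 \<and> 0 \<le> r \<and> r \<le> 1 \<longrightarrow> DERIV (g m) r :> g (Suc m) r"
    using line by (auto simp: g_def intro!: DERIV_along_line)
  from Taylor_up[of 3 g "g 0", OF _ _ this, of 0]
  obtain r :: real where r: "0 < r" "r < 1"
    "g 0 1 = (\<Sum>m<3. g m 0 / fact m * (1 - 0) ^ m) + g 3 r / fact 3 * (1 - 0) ^ 3"
    by auto
  show ?thesis
  proof (rule that)
    show "x + r *\<^sub>R h \<in> S" using line r by simp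
    show "f (x + h) = f x + dir_deriv f h x + dir_deriv (dir_deriv f h) h x / 2
       + dir_deriv (dir_deriv (dir_deriv f h) h) h (x + r *\<^sub>R h) / 6"
      using r(3) by (simp add: g_def numeral_3_eq_3 fact_numeral)
  qed
qed

text \<open>The norm of a nested vector is the Euclidean norm of the norms of its entries, so
  estimates of multilinear forms can be iterated one index at a time. This is how the Euclidean norm
  of a matrix or a three-way array comes to dominate the form it defines.\<close>

lemma norm_vec_le_mult:
  fixes x :: "'a::real_normed_vector ^ 'n" and y :: "'b::real_normed_vector ^ 'n"
  assumes "\<And>i. norm (x $ i) \<le> B * norm (y $ i)" "0 \<le> B"
  shows "norm x \<le> B * norm y"
proof -
  have "norm x \<le> L2_set (\<lambda>i. B * norm (y $ i)) UNIV"
    unfolding norm_vec_def using assms by (intro L2_set_mono) auto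
  also have "\<dots> = B * norm y"
    using assms by (simp add: norm_vec_def L2_set_right_distrib)
  finally show ?thesis .
qed

lemma norm_matrix_vector_mult_le:
  fixes A :: "real ^ 'n ^ 'm"
  shows "norm (A *v c) \<le> norm c * norm A"
proof (rule norm_vec_le_mult)
  show "norm ((A *v c) $ i) \<le> norm c * norm (A $ i)" for i
    using Cauchy_Schwarz_ineq2[of "A $ i" c]
    by (simp add: matrix_vector_mult_def inner_vec_def mult.commute)
qed simp

lemma quadratic_form_le:
  fixes A :: "real ^ 'n ^ 'n"
  shows "\<bar>c \<bullet> (A *v c)\<bar> \<le> norm A * (norm c)\<^sup>2"
proof -
  have "\<bar>c \<bullet> (A *v c)\<bar> \<le> norm c * norm (A *v c)"
    by (rule Cauchy_Schwarz_ineq2)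
  also have "\<dots> \<le> norm c * (norm c * norm A)"
    by (intro mult_left_mono norm_matrix_vector_mult_le) simp
  finally show ?thesis by (simp add: power2_eq_square algebra_simps)
qed

text \<open>Contracting one index of \<open>T\<close> with \<open>c\<close> leaves a matrix of norm
  at most \<open>norm c * norm T\<close>, to which the bound for quadratic forms applies.\<close>

lemma cubic_form_le:
  fixes T :: "real ^ 'n ^ 'n ^ 'n" and c :: "real ^ 'n"
  shows "\<bar>\<Sum>k\<in>UNIV. \<Sum>j\<in>UNIV. \<Sum>i\<in>UNIV. c $ k * (c $ j * (c $ i * T $ k $ j $ i))\<bar>
           \<le> norm T * norm c ^ 3"
proof -
  have eq: "(\<Sum>k\<in>UNIV. \<Sum>j\<in>UNIV. \<Sum>i\<in>UNIV. c $ k * (c $ j * (c $ i * T $ k $ j $ i)))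
        = c \<bullet> ((\<chi> k. T $ k *v c) *v c)"
    by (simp add: inner_vec_def matrix_vector_mult_def sum_distrib_left sum_distrib_right ac_simps)
  have "norm (\<chi> k. T $ k *v c) \<le> norm c * norm T"
    by (rule norm_vec_le_mult) (auto simp: norm_matrix_vector_mult_le)
  then have "norm (\<chi> k. T $ k *v c) * (norm c)\<^sup>2 \<le> norm c * norm T * (norm c)\<^sup>2"
    by (rule mult_right_mono) simp
  then show ?thesis
    unfolding eq using quadratic_form_le[of c "\<chi> k. T $ k *v c"]
    by (simp add: power2_eq_square power3_eq_cube ac_simps)
qed

text \<open>Stated for an arbitrary finite family \<open>e\<close> of directions, so that one
  expansion serves both blocks of the parameter. The gradient bound uses up only one of the two
  factors \<open>s\<close>, which is why the linear term keeps a factor \<open>s\<close>; the scaled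
  Hessian is split into its limit \<open>C\<close> and an error of norm at most
  \<open>\<rho>\<close>.\<close>

lemma Taylor_lower_bound:
  fixes f :: "'a::euclidean_space \<Rightarrow> real" and e :: "'n::finite \<Rightarrow> 'a" and c :: "real ^ 'n"
  defines "h \<equiv> \<Sum>i\<in>UNIV. c $ i *\<^sub>R e i"
  assumes f: "Ck_on 3 S f" and S: "convex S" "open S" and x: "x \<in> S" "x + h \<in> S"
    and D1: "norm (s *\<^sub>R (\<chi> i. dir_deriv f (e i) x)) \<le> Z"
    and D2: "norm (s\<^sup>2 *\<^sub>R (\<chi> i j. dir_deriv (dir_deriv f (e j)) (e i) x) - C) \<le> \<rho>"
    and C: "\<mu> * (norm c)\<^sup>2 \<le> c \<bullet> (C *v c)"
    and D3: "\<And>y. y \<in> S \<Longrightarrow>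
      norm (s\<^sup>2 *\<^sub>R (\<chi> i j k. dir_deriv (dir_deriv (dir_deriv f (e k)) (e j)) (e i) y)) \<le> Z"
    and s: "0 < s"
  shows "\<mu> / 2 * (norm c)\<^sup>2 - s * Z * norm c - \<rho> / 2 * (norm c)\<^sup>2 - Z / 6 * norm c ^ 3
           \<le> s\<^sup>2 * (f (x + h) - f x)"
proof -
  note df = Ck_on_3[OF f]
  \<comment> \<open>\<open>f1\<close> and \<open>f2\<close> are the first and second derivatives
    along \<open>h\<close> in coordinates. The differentiation performed last carries the outer
    index, in agreement with the arrays in \<open>D2\<close> and \<open>D3\<close>.\<close>
  define f1 where "f1 = (\<lambda>y. \<Sum>i\<in>UNIV. c $ i * dir_deriv f (e i) y)"
  define f2 where "f2 = (\<lambda>y. \<Sum>j\<in>UNIV. c $ j * (\<Sum>i\<in>UNIV. c $ i * dir_deriv (dir_deriv f (e i)) (e j) y))"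
  have d1: "dir_deriv f h y = f1 y" if "y \<in> S" for y
    unfolding h_def f1_def using dir_deriv_linear_combination df(1)[OF that] by blast
  have f1_diff: "f1 differentiable (at y)" if "y \<in> S" for y
    unfolding f1_def using df(2)[OF that] by (intro differentiable_sum differentiable_mult) auto
  have d2: "dir_deriv (dir_deriv f h) h y = f2 y" if y: "y \<in> S" for y
  proof -
    have "dir_deriv (dir_deriv f h) h y = dir_deriv f1 h y"
      \<comment> \<open>The coordinate form of \<open>dir_deriv f h\<close> is valid only on
        \<open>S\<close>; since \<open>S\<close> is open, that suffices for differentiating it once
        more at a point of \<open>S\<close>.\<close>
      using df(2)[OF y] S(2) y d1 by (rule dir_deriv_cong_open)
    also have "\<dots> = (\<Sum>j\<in>UNIV. c $ j * dir_deriv f1 (e j) y)"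
      unfolding h_def using dir_deriv_linear_combination f1_diff[OF y] by blast
    also have "\<dots> = f2 y"
      unfolding f1_def f2_def using df(2)[OF y] by (simp add: dir_deriv_sum_functions)
    finally show ?thesis .
  qed
  have f2_diff: "f2 differentiable (at y)" if "y \<in> S" for y
    unfolding f2_def using df(3)[OF that] by (intro differentiable_sum differentiable_mult) auto
  have d3: "dir_deriv (dir_deriv (dir_deriv f h) h) h y = (\<Sum>k\<in>UNIV. \<Sum>j\<in>UNIV. \<Sum>i\<in>UNIV.
      c $ k * (c $ j * (c $ i * dir_deriv (dir_deriv (dir_deriv f (e i)) (e j)) (e k) y)))"
    if y: "y \<in> S" for y
  proof -
    have "dir_deriv (dir_deriv (dir_deriv f h) h) h y = dir_deriv f2 h y"
      using df(3)[OF y] S(2) y d2 by (rule dir_deriv_cong_open)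
    also have "\<dots> = (\<Sum>k\<in>UNIV. c $ k * dir_deriv f2 (e k) y)"
      unfolding h_def using dir_deriv_linear_combination f2_diff[OF y] by blast
    also have "\<dots> = (\<Sum>k\<in>UNIV. c $ k * (\<Sum>j\<in>UNIV. c $ j * (\<Sum>i\<in>UNIV. c $ i *
        dir_deriv (dir_deriv (dir_deriv f (e i)) (e j)) (e k) y)))"
    proof -
      have "dir_deriv f2 d y = (\<Sum>j\<in>UNIV. c $ j * (\<Sum>i\<in>UNIV. c $ i *
        dir_deriv (dir_deriv (dir_deriv f (e i)) (e j)) d y))" for d
        unfolding f2_def using df(3)[OF y]
        by (subst dir_deriv_sum_functions)
           (auto simp: dir_deriv_sum_functions intro!: differentiable_sum differentiable_mult)
      then show ?thesis by simp
    qed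
    finally show ?thesis by (simp add: sum_distrib_left)
  qed
  obtain y where y: "y \<in> S" "f (x + h) = f x + dir_deriv f h x + dir_deriv (dir_deriv f h) h x / 2
       + dir_deriv (dir_deriv (dir_deriv f h) h) h y / 6"
    using second_order_Taylor[OF f S(1) x] .
  define G where "G = s *\<^sub>R (\<chi> i. dir_deriv f (e i) x)"
  define A where "A = s\<^sup>2 *\<^sub>R (\<chi> i j. dir_deriv (dir_deriv f (e j)) (e i) x)"
  define T where "T = s\<^sup>2 *\<^sub>R (\<chi> i j k. dir_deriv (dir_deriv (dir_deriv f (e k)) (e j)) (e i) y)"
  have "s * dir_deriv f h x = c \<bullet> G"
    using d1[OF x(1)] by (simp add: G_def f1_def inner_vec_def sum_distrib_left ac_simps)
  also have "\<bar>\<dots>\<bar> \<le> norm c * norm G" by (rule Cauchy_Schwarz_ineq2)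
  also have "\<dots> \<le> norm c * Z" using D1 by (intro mult_left_mono) (auto simp: G_def)
  finally have "- (s * dir_deriv f h x) \<le> norm c * Z" by linarith
  then have "s * - (s * dir_deriv f h x) \<le> s * (norm c * Z)"
    using s by (intro mult_left_mono) auto
  then have 1: "- (s * Z * norm c) \<le> s\<^sup>2 * dir_deriv f h x"
    by (simp add: power2_eq_square algebra_simps)
  have "s\<^sup>2 * dir_deriv (dir_deriv f h) h x = c \<bullet> (A *v c)"
    using d2[OF x(1)]
    by (simp add: A_def f2_def inner_vec_def matrix_vector_mult_def sum_distrib_left ac_simps)
  also have "\<dots> = c \<bullet> (C *v c) + c \<bullet> ((A - C) *v c)"
    by (simp add: matrix_vector_mult_diff_rdistrib inner_diff_right)
  finally have 2: "\<mu> * (norm c)\<^sup>2 - \<rho> * (norm c)\<^sup>2 \<le> s\<^sup>2 * dir_deriv (dir_deriv f h) h x"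
    using C quadratic_form_le[of c "A - C"] mult_right_mono[OF D2, of "(norm c)\<^sup>2"]
    by (simp add: A_def)
  have "s\<^sup>2 * dir_deriv (dir_deriv (dir_deriv f h) h) h y
      = (\<Sum>k\<in>UNIV. \<Sum>j\<in>UNIV. \<Sum>i\<in>UNIV. c $ k * (c $ j * (c $ i * T $ k $ j $ i)))"
    using d3[OF y(1)] by (simp add: T_def sum_distrib_left ac_simps)
  also have "\<bar>\<dots>\<bar> \<le> norm T * norm c ^ 3" by (rule cubic_form_le)
  also have "\<dots> \<le> Z * norm c ^ 3"
    using D3[OF y(1)] by (intro mult_right_mono) (auto simp: T_def)
  finally have 3: "- (Z * norm c ^ 3) \<le> s\<^sup>2 * dir_deriv (dir_deriv (dir_deriv f h) h) h y"
    by linarith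
  have "s\<^sup>2 * (f (x + h) - f x) = s\<^sup>2 * dir_deriv f h x + s\<^sup>2 * dir_deriv (dir_deriv f h) h x / 2
       + s\<^sup>2 * dir_deriv (dir_deriv (dir_deriv f h) h) h y / 6"
    unfolding y(2) by (simp add: algebra_simps)
  with 1 2 3 show ?thesis by (simp add: field_simps)
qed

section \<open>Quadratic forms and the smallest eigenvalue\<close>

lemma symmetric_matrix_inner:
  assumes "symmetric_matrix A"
  shows "x \<bullet> (A *v y) = (A *v x) \<bullet> y"
  using assms dot_lmul_matrix[of x A y]
  by (metis symmetric_matrix_def transpose_matrix_vector)

text \<open>Eigenvectors chosen for distinct eigenvalues are orthogonal and nonzero, hence
  independent. Finiteness gives \<open>Min\<close> in \<open>lambda_min\<close> its expected
  meaning.\<close>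

lemma finite_eigenvalues_symmetric:
  fixes A :: "real ^ 'n ^ 'n"
  assumes "symmetric_matrix A"
  shows "finite {l. \<exists>v. v \<noteq> 0 \<and> A *v v = l *\<^sub>R v}" (is "finite ?L")
proof -
  define V where "V l = (SOME v. v \<noteq> 0 \<and> A *v v = l *\<^sub>R v)" for l
  have V: "V l \<noteq> 0 \<and> A *v V l = l *\<^sub>R V l" if "l \<in> ?L" for l
    unfolding V_def using that by (intro someI_ex[of "\<lambda>v. v \<noteq> 0 \<and> A *v v = l *\<^sub>R v"]) blast
  have inj: "inj_on V ?L"
  proof (rule inj_onI)
    fix l m assume "l \<in> ?L" "m \<in> ?L" "V l = V m"
    then have "l *\<^sub>R V l = m *\<^sub>R V l" "V l \<noteq> 0" using V[of l] V[of m] by metis+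
    then show "l = m" by simp
  qed
  have "V l \<bullet> V m = 0" if "l \<in> ?L" "m \<in> ?L" "l \<noteq> m" for l m
    using symmetric_matrix_inner[OF assms, of "V l" "V m"] V[OF that(1)] V[OF that(2)] that(3)
    by simp
  then have "pairwise orthogonal (V ` ?L)"
    by (auto simp: pairwise_def orthogonal_def)
  moreover have "0 \<notin> V ` ?L" using V by force
  ultimately have "finite (V ` ?L)"
    using independent_bound pairwise_orthogonal_independent by blast
  then show ?thesis using inj finite_imageD by blast
qed

text \<open>The minimum over the unit sphere exists by compactness and extends to all vectors by
  homogeneity of degree two.\<close>

lemma quadratic_form_min_sphere:
  fixes A :: "real ^ 'n ^ 'n"
  obtains v where "norm v = 1" "\<And>x. (v \<bullet> (A *v v)) * (norm x)\<^sup>2 \<le> x \<bullet> (A *v x)"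
proof -
  have "continuous_on (sphere 0 1) (\<lambda>x::real^'n. x \<bullet> (A *v x))"
    by (intro continuous_on_inner continuous_on_id linear_continuous_on matrix_vector_mul_bounded_linear)
  from continuous_attains_inf[OF compact_sphere _ this]
  obtain v :: "real^'n" where v: "norm v = 1"
      "\<And>x. norm x = 1 \<Longrightarrow> v \<bullet> (A *v v) \<le> x \<bullet> (A *v x)"
    by auto
  have "(v \<bullet> (A *v v)) * (norm x)\<^sup>2 \<le> x \<bullet> (A *v x)" for x
  proof (cases "x = 0")
    case False
    define y where "y = (1 / norm x) *\<^sub>R x"
    have "x = norm x *\<^sub>R y" using False by (simp add: y_def)
    then have "x \<bullet> (A *v x) = (norm x)\<^sup>2 * (y \<bullet> (A *v y))"
      by (metis (no_types, lifting) inner_scaleR_left inner_scaleR_right matrix_vector_mult_scaleR mult.assoc power2_eq_square)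
    moreover have "norm y = 1" using False by (simp add: y_def)
    ultimately show ?thesis using v(2)[of y] by (simp add: mult.commute mult_right_mono)
  qed simp
  with v(1) show ?thesis by (rule that)
qed

text \<open>The minimum \<open>\<mu>\<close> of the form on the unit sphere is shown to be an
  eigenvalue; hence \<open>lambda_min A \<le> \<mu>\<close>, while \<open>\<mu>\<close> bounds the
  form from below.\<close>

lemma lambda_min_le_quadratic_form:
  fixes A :: "real ^ 'n ^ 'n"
  assumes sym: "symmetric_matrix A"
  shows "lambda_min A * (norm x)\<^sup>2 \<le> x \<bullet> (A *v x)"
proof -
  obtain v where v: "norm v = 1" "\<And>x. (v \<bullet> (A *v v)) * (norm x)\<^sup>2 \<le> x \<bullet> (A *v x)"
    using quadratic_form_min_sphere[of A] by blast
  define \<mu> where "\<mu> = v \<bullet> (A *v v)"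
  define w where "w = A *v v - \<mu> *\<^sub>R v"
  \<comment> \<open>Along any direction the nonnegative form \<open>x \<bullet> A x - \<mu> |x|\<^sup>2\<close> has a zero, hence a critical point, at \<open>v\<close>.\<close>
  have nonneg: "0 \<le> 2 * r * (w \<bullet> w) + r\<^sup>2 * (w \<bullet> (A *v w) - \<mu> * (w \<bullet> w))" for r :: real
  proof -
    have "\<mu> * ((v + r *\<^sub>R w) \<bullet> (v + r *\<^sub>R w)) \<le> (v + r *\<^sub>R w) \<bullet> (A *v (v + r *\<^sub>R w))"
      using v(2)[of "v + r *\<^sub>R w"] by (simp add: \<mu>_def power2_norm_eq_inner)
    moreover have "v \<bullet> (A *v w) = (A *v v) \<bullet> w"
      by (rule symmetric_matrix_inner[OF sym])
    moreover have "w \<bullet> (A *v v) = w \<bullet> w + \<mu> * (v \<bullet> w)"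
    proof -
      have "w \<bullet> w = w \<bullet> (A *v v - \<mu> *\<^sub>R v)" by (simp add: w_def)
      then show ?thesis by (simp add: inner_diff_right inner_commute[of w v])
    qed
    moreover have "v \<bullet> v = 1" using v(1) by (simp add: norm_eq_1)
    ultimately show ?thesis
      by (simp add: matrix_vector_right_distrib matrix_vector_mult_scaleR inner_add_left
          inner_add_right inner_commute \<mu>_def[symmetric] power2_eq_square algebra_simps)
  qed
  have "w \<bullet> w = 0"
  proof (rule ccontr)
    assume "w \<bullet> w \<noteq> 0"
    then have W: "0 < w \<bullet> w" by simp
    \<comment> \<open>\<open>q\<close> is a positive majorant of the quadratic coefficient in
      \<open>nonneg\<close>. At \<open>r = - (w \<bullet> w) / q\<close> the quadratic term is at
      most half the size of the negative linear term, which contradicts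
      \<open>nonneg\<close>.\<close>
    define q where "q = \<bar>w \<bullet> (A *v w) - \<mu> * (w \<bullet> w)\<bar> + w \<bullet> w"
    have q: "0 < q" using W by (simp add: q_def add_nonneg_pos)
    define r where "r = - (w \<bullet> w) / q"
    have "r\<^sup>2 * (w \<bullet> (A *v w) - \<mu> * (w \<bullet> w)) \<le> r\<^sup>2 * q"
    proof (rule mult_left_mono)
      show "w \<bullet> (A *v w) - \<mu> * (w \<bullet> w) \<le> q" unfolding q_def using W by linarith
    qed simp
    also have "\<dots> = - r * (w \<bullet> w)"
      using q by (simp add: r_def power2_eq_square)
    finally have "0 \<le> r * (w \<bullet> w)" using nonneg[of r] by linarith
    moreover have "r < 0" using W q by (simp add: r_def)
    ultimately show False using W by (simp add: zero_le_mult_iff)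
  qed
  then have "A *v v = \<mu> *\<^sub>R v" by (simp add: w_def)
  moreover have "v \<noteq> 0" using v(1) by auto
  ultimately have "lambda_min A \<le> \<mu>"
    unfolding lambda_min_def using finite_eigenvalues_symmetric[OF sym] by (intro Min_le) auto
  then have "lambda_min A * (norm x)\<^sup>2 \<le> \<mu> * (norm x)\<^sup>2" by (rule mult_right_mono) simp
  with v(2)[of x] show ?thesis by (simp add: \<mu>_def)
qed

lemma positive_definite_coercive:
  fixes A :: "real ^ 'n ^ 'n"
  assumes "positive_definite A"
  obtains \<mu> where "0 < \<mu>" "\<And>x. \<mu> * (norm x)\<^sup>2 \<le> x \<bullet> (A *v x)"
proof -
  obtain v where v: "norm v = 1" "\<And>x. (v \<bullet> (A *v v)) * (norm x)\<^sup>2 \<le> x \<bullet> (A *v x)"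
    using quadratic_form_min_sphere[of A] by blast
  moreover have "v \<noteq> 0" using v(1) by auto
  ultimately show ?thesis using assms that by (auto simp: positive_definite_def)
qed

section \<open>The rate inequality for one block\<close>

text \<open>\<open>C\<close> and \<open>m\<close> are chosen before \<open>s\<close>,
  \<open>x\<close> and \<open>Z\<close>, because the bound is applied at every sample point and for
  every \<open>n\<close> with the same constants. No smallness of \<open>s\<close> is assumed: for
  \<open>1 \<le> s\<close> the bound \<open>x \<le> D\<close> suffices. The summand
  \<open>Z * s\<^sup>2\<close> makes room for the second block, where the error of the first one
  enters as an additive constant.\<close>

lemma rescaled_error_bound:
  fixes \<kappa> \<mu> \<delta>1 \<delta>2 D :: real
  assumes pos: "0 < \<kappa>" "0 < \<mu>" "0 < \<delta>1" "0 < \<delta>2" "0 \<le> D"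
  obtains C m where "0 < C" "0 < m"
    "\<And>s x Z. \<lbrakk>0 < s; 0 \<le> x; x \<le> D; 1 \<le> Z;
       \<kappa> * x\<^sup>2 \<le> s powr (2 * \<delta>1) * Z + Z * (s\<^sup>2 + s * x);
       \<mu> * x\<^sup>2 \<le> Z * (s\<^sup>2 + s * x) + s powr (2 * \<delta>2) * Z * x\<^sup>2 + Z * x ^ 3\<rbrakk>
     \<Longrightarrow> x / s \<le> C * Z powr m"
proof -
  \<comment> \<open>The entry \<open>1/2\<close> ensures that
    \<open>s \<le> s powr (2 * \<epsilon>)\<close> for \<open>s < 1\<close>, so the linear term
    \<open>s * x\<close> fits under the same power of \<open>s\<close>.\<close>
  define \<epsilon> where "\<epsilon> = min \<delta>1 (min \<delta>2 (1/2))"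
  have \<epsilon>: "0 < \<epsilon>" "\<epsilon> \<le> \<delta>1" "\<epsilon> \<le> \<delta>2" "2 * \<epsilon> \<le> 1" using pos by (auto simp: \<epsilon>_def)
  \<comment> \<open>\<open>A\<close> is the constant of the rough estimate, \<open>B\<close>
    normalizes the failure of absorption to \<open>1 < B * s powr \<epsilon> * Z\<^sup>2\<close>,
    and \<open>C\<close> adds up the constants of the three cases: large \<open>s\<close>,
    perturbation absorbed, perturbation not absorbed.\<close>
  define A where "A = sqrt ((2 + D) / \<kappa>)"
  define B where "B = 2 * (1 + A) / \<mu>"
  define m where "m = max 1 (2 / \<epsilon>)"
  define C where "C = D + 1 + 4 / \<mu> + D * B powr (1 / \<epsilon>)"
  have A: "0 < A" "A\<^sup>2 = (2 + D) / \<kappa>" using pos by (auto simp: A_def)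
  have B: "0 < B" using A pos by (simp add: B_def)
  have C: "D \<le> C" "1 + 4 / \<mu> \<le> C" "D * B powr (1 / \<epsilon>) \<le> C" "0 < C"
    using pos by (auto simp: C_def add_nonneg_pos add_pos_nonneg)
  have "x / s \<le> C * Z powr m"
    if s: "0 < s" and x: "0 \<le> x" "x \<le> D" and Z: "1 \<le> Z"
      and i: "\<kappa> * x\<^sup>2 \<le> s powr (2 * \<delta>1) * Z + Z * (s\<^sup>2 + s * x)"
      and ii: "\<mu> * x\<^sup>2 \<le> Z * (s\<^sup>2 + s * x) + s powr (2 * \<delta>2) * Z * x\<^sup>2 + Z * x ^ 3"
    for s x Z
  proof -
    have Zm: "Z \<le> Z powr m" "1 \<le> Z powr m" "Z powr (2 / \<epsilon>) \<le> Z powr m"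
      using Z powr_mono[of 1 m Z] powr_mono[of "2 / \<epsilon>" m Z] by (auto simp: m_def ge_one_powr_ge_zero)
    have C_bound: "y \<le> C * Z powr m" if "y \<le> c * W" "c \<le> C" "W \<le> Z powr m" "0 \<le> W" for y c W
    proof -
      have "c * W \<le> C * Z powr m" using that C(4) by (intro mult_mono) auto
      with that(1) show ?thesis by simp
    qed
    show ?thesis
    proof (cases "1 \<le> s")
      case True
      then have "x / s \<le> x / 1" using x(1) by (intro divide_left_mono) auto
      with x(2) have "x / s \<le> D * 1" by simp
      then show ?thesis by (rule C_bound) (use C Zm in auto)
    next
      case False
      then have s1: "s < 1" by simp
      have le: "s powr b \<le> s powr a" if "a \<le> b" for a b :: real
        using s s1 that powr_mono'[of a b s] by simp
      have "s * (s + x) \<le> s powr (2 * \<epsilon>) * (1 + D)"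
        using le[of "2 * \<epsilon>" 1] \<epsilon> s s1 x by (intro mult_mono) auto
      then have "\<kappa> * x\<^sup>2 \<le> s powr (2 * \<epsilon>) * Z + Z * (s powr (2 * \<epsilon>) * (1 + D))"
      proof -
        have "s powr (2 * \<delta>1) * Z \<le> s powr (2 * \<epsilon>) * Z"
          using le[of "2 * \<epsilon>" "2 * \<delta>1"] \<epsilon> Z by (intro mult_right_mono) auto
        moreover have "Z * (s * (s + x)) \<le> Z * (s powr (2 * \<epsilon>) * (1 + D))"
          using \<open>s * (s + x) \<le> s powr (2 * \<epsilon>) * (1 + D)\<close> Z by (intro mult_left_mono) auto
        moreover have "Z * (s\<^sup>2 + s * x) = Z * (s * (s + x))"
          by (simp add: algebra_simps power2_eq_square)
        ultimately show ?thesis using i by linarith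
      qed
      also have "\<dots> = s powr (2 * \<epsilon>) * Z * (2 + D)" by (simp add: algebra_simps)
      \<comment> \<open>Since \<open>1 \<le> Z\<close>, one more factor \<open>Z\<close> may be
        spent to make the right-hand side a perfect square.\<close>
      also have "\<dots> \<le> s powr (2 * \<epsilon>) * Z\<^sup>2 * (2 + D)"
        using Z pos by (intro mult_mono) (auto simp: power2_eq_square)
      also have "\<dots> = \<kappa> * (A * s powr \<epsilon> * Z)\<^sup>2"
        using pos s by (simp add: power_mult_distrib A(2) powr_power ac_simps)
      finally have "x\<^sup>2 \<le> (A * s powr \<epsilon> * Z)\<^sup>2"
        using pos(1) by (simp only: mult_le_cancel_left_pos)
      then have xA: "x \<le> A * s powr \<epsilon> * Z"
        by (rule power2_le_imp_le) (use A Z in auto)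
      have rem: "s powr (2 * \<delta>2) * Z + Z * x \<le> (1 + A) * s powr \<epsilon> * Z\<^sup>2"
      proof -
        have "s powr (2 * \<delta>2) * Z \<le> s powr \<epsilon> * Z\<^sup>2"
          using le[of \<epsilon> "2 * \<delta>2"] \<epsilon> Z by (intro mult_mono) (auto simp: power2_eq_square)
        moreover have "Z * x \<le> Z * (A * s powr \<epsilon> * Z)" using xA Z by (intro mult_left_mono) auto
        ultimately show ?thesis by (simp add: algebra_simps power2_eq_square)
      qed
      show ?thesis
      proof (cases "(1 + A) * s powr \<epsilon> * Z\<^sup>2 \<le> \<mu> / 2")
        case True
        define y where "y = x / s"
        have xy: "x = s * y" using s by (simp add: y_def)
        have "s powr (2 * \<delta>2) * Z * x\<^sup>2 + Z * x ^ 3 = (s powr (2 * \<delta>2) * Z + Z * x) * x\<^sup>2"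
          by (simp add: algebra_simps power2_eq_square power3_eq_cube)
        also have "\<dots> \<le> \<mu> / 2 * x\<^sup>2" using rem True by (intro mult_right_mono) auto
        finally have "\<mu> / 2 * x\<^sup>2 \<le> Z * (s\<^sup>2 + s * x)" using ii by linarith
        then have "s\<^sup>2 * (\<mu> / 2 * y\<^sup>2) \<le> s\<^sup>2 * (Z * (1 + y))"
          by (simp add: xy algebra_simps power2_eq_square)
        then have y2: "\<mu> / 2 * y\<^sup>2 \<le> Z * (1 + y)"
          using s by (simp only: mult_le_cancel_left_pos zero_less_power)
        have "y \<le> (1 + 4 / \<mu>) * Z"
        proof (cases "1 \<le> y")
          case True
          have "Z * (1 + y) \<le> Z * (2 * y)" using True Z by (intro mult_left_mono) auto
          with y2 have "\<mu> / 2 * y * y \<le> Z * 2 * y" by (simp add: power2_eq_square)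
          then have "\<mu> / 2 * y \<le> Z * 2" by (rule mult_right_le_imp_le) (use True in auto)
          then have "y \<le> 4 / \<mu> * Z" using pos by (simp add: field_simps)
          then show ?thesis using Z by (simp add: distrib_right)
        next
          case False
          have "y \<le> 1 * 1" using False by simp
          also have "\<dots> \<le> (1 + 4 / \<mu>) * Z" using pos Z by (intro mult_mono) auto
          finally show ?thesis .
        qed
        then show ?thesis unfolding y_def by (rule C_bound) (use C Zm Z in auto)
      next
        case False
        then have "1 < B * s powr \<epsilon> * Z\<^sup>2" using pos by (simp add: B_def field_simps)
        \<comment> \<open>Raising to the power \<open>1 / \<epsilon>\<close> isolates
          \<open>s\<close> itself; dividing \<open>x \<le> D\<close> by \<open>s\<close> then costs
          only a power of \<open>Z\<close>.\<close>
        then have "1 powr (1 / \<epsilon>) < (B * s powr \<epsilon> * Z\<^sup>2) powr (1 / \<epsilon>)"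
          using \<epsilon> by (intro powr_less_mono2) auto
        also have "\<dots> = B powr (1 / \<epsilon>) * s * Z powr (2 / \<epsilon>)"
        proof -
          have "(Z powr 2) powr (1 / \<epsilon>) = Z powr (2 / \<epsilon>)" by (simp only: powr_powr) simp
          then have "(Z\<^sup>2) powr (1 / \<epsilon>) = Z powr (2 / \<epsilon>)" using Z by simp
          then show ?thesis using B s Z \<epsilon> by (simp add: powr_mult powr_powr)
        qed
        finally have "D * 1 \<le> D * (B powr (1 / \<epsilon>) * s * Z powr (2 / \<epsilon>))"
          using pos by (intro mult_left_mono) auto
        with x(2) have "x \<le> D * B powr (1 / \<epsilon>) * Z powr (2 / \<epsilon>) * s"
          by (simp add: ac_simps)
        then have "x / s \<le> D * B powr (1 / \<epsilon>) * Z powr (2 / \<epsilon>)"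
          using s by (simp add: pos_divide_le_eq)
        then show ?thesis by (rule C_bound) (use C Zm in auto)
      qed
    qed
  qed
  moreover have "0 < m" by (simp add: m_def)
  ultimately show ?thesis using C(4) by (intro that[of C m])
qed

section \<open>Variables with uniformly bounded moments of all orders\<close>

text \<open>Counterpart of \<open>moments_bounded\<close> for a single dominating variable per
  \<open>n\<close>. Measurability is built in so that the integrals are additive, and nonnegativity
  so that \<open>powr\<close> is monotone in the variable; this makes the class closed under sums,
  products and positive powers.\<close>

definition bounded_moments :: "'w measure \<Rightarrow> (nat \<Rightarrow> 'w \<Rightarrow> real) \<Rightarrow> bool" where
  "bounded_moments P Z \<longleftrightarrow> (\<forall>n. Z n \<in> borel_measurable P) \<and> (\<forall>n \<omega>. 0 \<le> Z n \<omega>) \<and>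
     (\<forall>K>0. \<exists>B<\<infinity>. \<forall>n. (\<integral>\<^sup>+\<omega>. ennreal (Z n \<omega> powr K) \<partial>P) \<le> B)"

lemma bounded_momentsI:
  assumes "\<And>n. Z n \<in> borel_measurable P" "\<And>n \<omega>. 0 \<le> Z n \<omega>"
    and "\<And>K. 0 < K \<Longrightarrow> \<exists>B<\<infinity>. \<forall>n. (\<integral>\<^sup>+\<omega>. ennreal (Z n \<omega> powr K) \<partial>P) \<le> B"
  shows "bounded_moments P Z"
  using assms by (simp add: bounded_moments_def)

lemma bounded_momentsD:
  assumes "bounded_moments P Z"
  shows "Z n \<in> borel_measurable P" and "0 \<le> Z n \<omega>"
  using assms by (auto simp: bounded_moments_def)

lemma bounded_moments_bound:
  assumes "bounded_moments P Z" "0 < K"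
  obtains B :: real where "0 \<le> B" "\<And>n. (\<integral>\<^sup>+\<omega>. ennreal (Z n \<omega> powr K) \<partial>P) \<le> ennreal B"
proof -
  obtain B where B: "B < \<infinity>" "\<And>n. (\<integral>\<^sup>+\<omega>. ennreal (Z n \<omega> powr K) \<partial>P) \<le> B"
    using assms by (auto simp: bounded_moments_def)
  then have "B = ennreal (enn2real B)" by simp
  with B(2) show ?thesis by (intro that[of "enn2real B"]) auto
qed

lemma bounded_moments_dominated:
  assumes Z: "bounded_moments P Z" and c: "0 \<le> c"
    and Y: "\<And>n. Y n \<in> borel_measurable P" "\<And>n \<omega>. 0 \<le> Y n \<omega>"
    and le: "\<And>n. AE \<omega> in P. Y n \<omega> \<le> c * Z n \<omega>"
  shows "bounded_moments P Y"
proof (rule bounded_momentsI)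
  fix K :: real assume K: "0 < K"
  obtain B where B: "0 \<le> B" "\<And>n. (\<integral>\<^sup>+\<omega>. ennreal (Z n \<omega> powr K) \<partial>P) \<le> ennreal B"
    using bounded_moments_bound[OF Z K] by blast
  have "(\<integral>\<^sup>+\<omega>. ennreal (Y n \<omega> powr K) \<partial>P) \<le> ennreal (c powr K * B)" for n
  proof -
    have "(\<integral>\<^sup>+\<omega>. ennreal (Y n \<omega> powr K) \<partial>P) \<le> (\<integral>\<^sup>+\<omega>. ennreal (c powr K) * ennreal (Z n \<omega> powr K) \<partial>P)"
    proof (rule nn_integral_mono_AE)
      show "AE \<omega> in P. ennreal (Y n \<omega> powr K) \<le> ennreal (c powr K) * ennreal (Z n \<omega> powr K)"
        using le[of n]
      proof eventually_elim
        case (elim \<omega>)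
        have "Y n \<omega> powr K \<le> (c * Z n \<omega>) powr K"
          using elim Y(2) K by (intro powr_mono2) auto
        then show ?case
          using c bounded_momentsD(2)[OF Z] by (simp add: powr_mult ennreal_leI flip: ennreal_mult)
      qed
    qed
    also have "\<dots> = ennreal (c powr K) * (\<integral>\<^sup>+\<omega>. ennreal (Z n \<omega> powr K) \<partial>P)"
      using bounded_momentsD(1)[OF Z, measurable] by (intro nn_integral_cmult) measurable
    also have "\<dots> \<le> ennreal (c powr K) * ennreal B"
      by (intro mult_left_mono B) simp
    finally show ?thesis using B by (simp add: ennreal_mult)
  qed
  then show "\<exists>B<\<infinity>. \<forall>n. (\<integral>\<^sup>+\<omega>. ennreal (Y n \<omega> powr K) \<partial>P) \<le> B"
    by (intro exI[of _ "ennreal (c powr K * B)"]) auto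
qed (use Y in auto)

lemma bounded_moments_const:
  assumes "prob_space P" "0 \<le> c"
  shows "bounded_moments P (\<lambda>n \<omega>. c)"
proof (rule bounded_momentsI)
  interpret prob_space P by fact
  show "\<exists>B<\<infinity>. \<forall>n::nat. (\<integral>\<^sup>+\<omega>. ennreal (c powr K) \<partial>P) \<le> B" for K
    by (intro exI[of _ "ennreal (c powr K)"]) (simp add: emeasure_space_1)
qed (use assms in auto)

lemma bounded_moments_add:
  assumes Y: "bounded_moments P Y" and Z: "bounded_moments P Z"
  shows "bounded_moments P (\<lambda>n \<omega>. Y n \<omega> + Z n \<omega>)"
proof (rule bounded_momentsI)
  note [measurable] = bounded_momentsD(1)[OF Y] bounded_momentsD(1)[OF Z]
  note nonneg = bounded_momentsD(2)[OF Y] bounded_momentsD(2)[OF Z]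
  show "(\<lambda>\<omega>. Y n \<omega> + Z n \<omega>) \<in> borel_measurable P" for n by measurable
  show "0 \<le> Y n \<omega> + Z n \<omega>" for n \<omega> using nonneg by simp
  fix K :: real assume K: "0 < K"
  obtain B where B: "0 \<le> B" "\<And>n. (\<integral>\<^sup>+\<omega>. ennreal (Y n \<omega> powr K) \<partial>P) \<le> ennreal B"
    using bounded_moments_bound[OF Y K] by blast
  obtain C where C: "0 \<le> C" "\<And>n. (\<integral>\<^sup>+\<omega>. ennreal (Z n \<omega> powr K) \<partial>P) \<le> ennreal C"
    using bounded_moments_bound[OF Z K] by blast
  \<comment> \<open>Passing through the maximum covers every \<open>K > 0\<close>, including
    \<open>K < 1\<close>, where \<open>powr K\<close> is not convex.\<close>
  have *: "(x + y) powr K \<le> 2 powr K * (x powr K + y powr K)" if "0 \<le> x" "0 \<le> y" for x y :: real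
  proof -
    have "(x + y) powr K \<le> (2 * max x y) powr K" using that K by (intro powr_mono2) auto
    also have "\<dots> = 2 powr K * max x y powr K" using that by (simp add: powr_mult)
    also have "\<dots> \<le> 2 powr K * (x powr K + y powr K)" by (intro mult_left_mono) (auto simp: max_def)
    finally show ?thesis .
  qed
  have "(\<integral>\<^sup>+\<omega>. ennreal ((Y n \<omega> + Z n \<omega>) powr K) \<partial>P) \<le> ennreal (2 powr K * (B + C))" for n
  proof -
    have "(\<integral>\<^sup>+\<omega>. ennreal ((Y n \<omega> + Z n \<omega>) powr K) \<partial>P)
        \<le> (\<integral>\<^sup>+\<omega>. ennreal (2 powr K) * (ennreal (Y n \<omega> powr K) + ennreal (Z n \<omega> powr K)) \<partial>P)"
      using * nonneg by (intro nn_integral_mono) (simp flip: ennreal_mult ennreal_plus)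
    also have "\<dots> = ennreal (2 powr K) *
        ((\<integral>\<^sup>+\<omega>. ennreal (Y n \<omega> powr K) \<partial>P) + (\<integral>\<^sup>+\<omega>. ennreal (Z n \<omega> powr K) \<partial>P))"
      by (simp add: nn_integral_cmult nn_integral_add)
    also have "\<dots> \<le> ennreal (2 powr K) * (ennreal B + ennreal C)"
      by (intro mult_left_mono add_mono B C) simp
    finally show ?thesis using B C by (simp add: ennreal_mult)
  qed
  then show "\<exists>B<\<infinity>. \<forall>n. (\<integral>\<^sup>+\<omega>. ennreal ((Y n \<omega> + Z n \<omega>) powr K) \<partial>P) \<le> B"
    by (intro exI[of _ "ennreal (2 powr K * (B + C))"]) auto
qed

lemma bounded_moments_powr:
  assumes Z: "bounded_moments P Z" and m: "0 < m"
  shows "bounded_moments P (\<lambda>n \<omega>. Z n \<omega> powr m)"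
proof (rule bounded_momentsI)
  note [measurable] = bounded_momentsD(1)[OF Z]
  show "(\<lambda>\<omega>. Z n \<omega> powr m) \<in> borel_measurable P" for n by measurable
  fix K :: real assume "0 < K"
  then show "\<exists>B<\<infinity>. \<forall>n. (\<integral>\<^sup>+\<omega>. ennreal ((Z n \<omega> powr m) powr K) \<partial>P) \<le> B"
    using Z m by (auto simp: powr_powr bounded_moments_def)
qed simp

lemma bounded_moments_cmult:
  assumes "bounded_moments P Z" "0 \<le> c"
  shows "bounded_moments P (\<lambda>n \<omega>. c * Z n \<omega>)"
  using assms(2) bounded_momentsD[OF assms(1)]
  by (intro bounded_moments_dominated[OF assms]) (auto intro!: borel_measurable_times)

text \<open>The inequality \<open>y * z \<le> y\<^sup>2 + z\<^sup>2\<close> reduces products to sums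
  and powers.\<close>

lemma bounded_moments_mult:
  assumes Y: "bounded_moments P Y" and Z: "bounded_moments P Z"
  shows "bounded_moments P (\<lambda>n \<omega>. Y n \<omega> * Z n \<omega>)"
proof (rule bounded_moments_dominated[where c = 1 and Z = "\<lambda>n \<omega>. Y n \<omega> powr 2 + Z n \<omega> powr 2"])
  note [measurable] = bounded_momentsD(1)[OF Y] bounded_momentsD(1)[OF Z]
  note nonneg = bounded_momentsD(2)[OF Y] bounded_momentsD(2)[OF Z]
  show "bounded_moments P (\<lambda>n \<omega>. Y n \<omega> powr 2 + Z n \<omega> powr 2)"
    using Y Z by (intro bounded_moments_add bounded_moments_powr) auto
  show "(\<lambda>\<omega>. Y n \<omega> * Z n \<omega>) \<in> borel_measurable P" for n by measurable
  show "0 \<le> Y n \<omega> * Z n \<omega>" for n \<omega> using nonneg by simp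
  have "Y n \<omega> * Z n \<omega> \<le> 1 * (Y n \<omega> powr 2 + Z n \<omega> powr 2)" for n \<omega>
  proof -
    have "0 \<le> (Y n \<omega> - Z n \<omega>)\<^sup>2 + (Y n \<omega>)\<^sup>2 + (Z n \<omega>)\<^sup>2" by simp
    then have "Y n \<omega> * Z n \<omega> \<le> (Y n \<omega>)\<^sup>2 + (Z n \<omega>)\<^sup>2" by (simp add: power2_diff)
    then show ?thesis using nonneg by simp
  qed
  then show "AE \<omega> in P. Y n \<omega> * Z n \<omega> \<le> 1 * (Y n \<omega> powr 2 + Z n \<omega> powr 2)" for n by simp
qed simp

lemma bounded_moments_sum:
  assumes "prob_space P" "finite A" "\<And>i. i \<in> A \<Longrightarrow> bounded_moments P (\<lambda>n \<omega>. Z n \<omega> i)"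
  shows "bounded_moments P (\<lambda>n \<omega>. \<Sum>i\<in>A. Z n \<omega> i)"
  using assms(2,3)
  by (induction A) (auto intro: bounded_moments_const[OF assms(1)] bounded_moments_add)

text \<open>There are finitely many indices, so bounds on each single moment pass to the sum, which
  is the quantity that appears in the penalty estimate.\<close>

lemma bounded_moments_MAX:
  fixes Y :: "nat \<Rightarrow> 'w \<Rightarrow> 'i::finite \<Rightarrow> real"
  assumes "prob_space P" and meas: "\<And>n i. (\<lambda>\<omega>. Y n \<omega> i) \<in> borel_measurable P"
    and bound: "\<forall>K>0. (SUP n. MAX i. \<integral>\<^sup>+\<omega>. ennreal (\<bar>Y n \<omega> i\<bar> powr K) \<partial>P) < \<infinity>"
  shows "bounded_moments P (\<lambda>n \<omega>. \<Sum>i\<in>UNIV. \<bar>Y n \<omega> i\<bar>)"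
proof (rule bounded_moments_sum[OF assms(1)])
  note [measurable] = meas
  show "bounded_moments P (\<lambda>n \<omega>. \<bar>Y n \<omega> i\<bar>)" for i
  proof (rule bounded_momentsI)
    fix K :: real assume K: "0 < K"
    have "(\<integral>\<^sup>+\<omega>. ennreal (\<bar>Y n \<omega> i\<bar> powr K) \<partial>P)
        \<le> (SUP n. MAX i. \<integral>\<^sup>+\<omega>. ennreal (\<bar>Y n \<omega> i\<bar> powr K) \<partial>P)" for n
      by (rule SUP_upper2[of n]) (auto intro!: Max_ge)
    then show "\<exists>B<\<infinity>. \<forall>n. (\<integral>\<^sup>+\<omega>. ennreal (\<bar>Y n \<omega> i\<bar> powr K) \<partial>P) \<le> B"
      using bound K by blast
  qed auto
qed simp

lemma moments_bounded_completion:
  "moments_bounded (completion P) S X \<longleftrightarrow> moments_bounded P S X"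
  by (simp add: moments_bounded_def nn_integral_completion)

text \<open>The way back from the completion: the envelope \<open>Z\<close> need not be measurable
  for \<open>P\<close> itself, but \<open>Y\<close> is, and integrals against \<open>P\<close> and
  its completion agree.\<close>

lemma bounded_moments_completion:
  assumes Z: "bounded_moments (completion P) Z"
    and Y: "\<And>n. Y n \<in> borel_measurable P" "\<And>n \<omega>. 0 \<le> Y n \<omega>"
    and le: "\<And>n. AE \<omega> in P. Y n \<omega> \<le> Z n \<omega>"
  shows "bounded_moments P Y"
proof -
  have "bounded_moments (completion P) Y"
    using Y le by (intro bounded_moments_dominated[OF Z, of 1]) (auto intro: measurable_completion AE_completion)
  with Y show ?thesis by (auto simp: bounded_moments_def nn_integral_completion)
qed

text \<open>Over a countable index set the supremum is measurable. Its finite mean makes it finite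
  almost everywhere, so turning it into a real number by \<open>enn2real\<close> preserves
  domination almost surely.\<close>

lemma moments_bounded_envelope:
  fixes X :: "nat \<Rightarrow> 'w \<Rightarrow> 'x \<Rightarrow> 'v::real_normed_vector"
  assumes X: "moments_bounded P S X" and D: "countable D" "D \<subseteq> S"
    and meas: "\<And>n x. x \<in> D \<Longrightarrow> (\<lambda>\<omega>. norm (X n \<omega> x)) \<in> borel_measurable P"
  obtains Z where "bounded_moments P Z" "\<And>n. AE \<omega> in P. \<forall>x\<in>D. norm (X n \<omega> x) \<le> Z n \<omega>"
proof -
  define E where "E n \<omega> = (SUP x\<in>D. ennreal (norm (X n \<omega> x)))" for n \<omega>
  define Z where "Z n \<omega> = enn2real (E n \<omega>)" for n \<omega>
  have E[measurable]: "E n \<in> borel_measurable P" for n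
    unfolding E_def using D(1) meas by (intro borel_measurable_SUP) auto
  have bound: "\<exists>B<\<infinity>. \<forall>n. (\<integral>\<^sup>+\<omega>. (SUP x\<in>D. ennreal (norm (X n \<omega> x) powr K)) \<partial>P) \<le> B" if "0 < K" for K
  proof (intro exI conjI allI)
    let ?B = "SUP n. \<integral>\<^sup>+\<omega>. (SUP x\<in>S. ennreal (norm (X n \<omega> x) powr K)) \<partial>P"
    show "?B < \<infinity>" using X that by (auto simp: moments_bounded_def)
    fix n
    have "(\<integral>\<^sup>+\<omega>. (SUP x\<in>D. ennreal (norm (X n \<omega> x) powr K)) \<partial>P)
        \<le> (\<integral>\<^sup>+\<omega>. (SUP x\<in>S. ennreal (norm (X n \<omega> x) powr K)) \<partial>P)"
      using D(2) by (intro nn_integral_mono SUP_subset_mono) auto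
    also have "\<dots> \<le> ?B" by (rule SUP_upper) simp
    finally show "(\<integral>\<^sup>+\<omega>. (SUP x\<in>D. ennreal (norm (X n \<omega> x) powr K)) \<partial>P) \<le> ?B" .
  qed
  have "bounded_moments P Z"
  proof (rule bounded_momentsI)
    show "Z n \<in> borel_measurable P" for n unfolding Z_def by measurable
    show "0 \<le> Z n \<omega>" for n \<omega> by (simp add: Z_def)
    fix K :: real assume K: "0 < K"
    \<comment> \<open>\<open>moments_bounded\<close> has the power inside the supremum; it is taken
      out by extracting the root of each member. Where the supremum is infinite the inequality is
      trivial, and there \<open>enn2real\<close> returns its default value 0.\<close>
    have le: "ennreal (Z n \<omega> powr K) \<le> (SUP x\<in>D. ennreal (norm (X n \<omega> x) powr K))" for n \<omega>
    proof (cases "(SUP x\<in>D. ennreal (norm (X n \<omega> x) powr K))")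
      case (real b)
      have "norm (X n \<omega> x) \<le> b powr (1 / K)" if "x \<in> D" for x
      proof -
        have "ennreal (norm (X n \<omega> x) powr K) \<le> ennreal b"
          unfolding real(2)[symmetric] using that by (rule SUP_upper)
        then have "norm (X n \<omega> x) powr K \<le> b" using real(1) by simp
        then have "(norm (X n \<omega> x) powr K) powr (1 / K) \<le> b powr (1 / K)"
          using K by (intro powr_mono2) auto
        then show ?thesis using K by (simp add: powr_powr)
      qed
      then have "E n \<omega> \<le> ennreal (b powr (1 / K))"
        unfolding E_def by (intro SUP_least ennreal_leI)
      then have "Z n \<omega> \<le> b powr (1 / K)" by (simp add: Z_def enn2real_leI)
      then have "Z n \<omega> powr K \<le> (b powr (1 / K)) powr K"
        using K by (intro powr_mono2) (auto simp: Z_def)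
      then show ?thesis using K real by (simp add: powr_powr)
    next
      case top
      then show ?thesis by (simp only: top_greatest)
    qed
    obtain B where "B < \<infinity>" "\<And>n. (\<integral>\<^sup>+\<omega>. (SUP x\<in>D. ennreal (norm (X n \<omega> x) powr K)) \<partial>P) \<le> B"
      using bound[OF K] by blast
    then show "\<exists>B<\<infinity>. \<forall>n. (\<integral>\<^sup>+\<omega>. ennreal (Z n \<omega> powr K) \<partial>P) \<le> B"
      by (intro exI[of _ B]) (auto intro: order_trans[OF nn_integral_mono[OF le]])
  qed
  moreover have "AE \<omega> in P. \<forall>x\<in>D. norm (X n \<omega> x) \<le> Z n \<omega>" for n
  proof -
    obtain B where B: "B < \<infinity>" "\<And>n. (\<integral>\<^sup>+\<omega>. (SUP x\<in>D. ennreal (norm (X n \<omega> x) powr 1)) \<partial>P) \<le> B"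
      using bound[of 1] by auto
    have "(\<integral>\<^sup>+\<omega>. E n \<omega> \<partial>P) \<le> B" using B(2)[of n] by (simp add: E_def)
    then have "(\<integral>\<^sup>+\<omega>. E n \<omega> \<partial>P) \<noteq> \<infinity>" using B(1) by (metis leD)
    then have "AE \<omega> in P. E n \<omega> \<noteq> \<infinity>" by (intro nn_integral_PInf_AE) auto
    then show ?thesis
    proof eventually_elim
      case (elim \<omega>)
      show ?case
      proof
        fix x assume "x \<in> D"
        then have "ennreal (norm (X n \<omega> x)) \<le> E n \<omega>" unfolding E_def by (rule SUP_upper)
        also have "E n \<omega> = ennreal (Z n \<omega>)" using elim by (simp add: Z_def top.not_eq_extremum)
        finally show "norm (X n \<omega> x) \<le> Z n \<omega>" by (simp add: Z_def)
      qed
    qed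
  qed
  ultimately show ?thesis by (rule that)
qed

section \<open>Measurability of derivatives in the completion\<close>

text \<open>In a complete measure space a change on a null set preserves measurability.\<close>

lemma measurable_completion_AE_cong:
  fixes f g :: "'w \<Rightarrow> 'b::topological_space"
  assumes f: "f \<in> borel_measurable (completion P)" and eq: "AE \<omega> in P. f \<omega> = g \<omega>"
  shows "g \<in> borel_measurable (completion P)"
proof (rule measurableI)
  fix A :: "'b set" assume A: "A \<in> sets borel"
  show "g -` A \<inter> space (completion P) \<in> sets (completion P)"
  proof (rule completion.in_sets_AE)
    show "f -` A \<inter> space (completion P) \<in> sets (completion P)"
      using f A by (rule measurable_sets)
    show "AE \<omega> in completion P. \<omega> \<in> f -` A \<inter> space (completion P) \<longleftrightarrow> \<omega> \<in> g -` A \<inter> space (completion P)"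
      using AE_completion[OF eq] by eventually_elim auto
  qed simp
qed simp

text \<open>Almost surely the derivative is a limit of difference quotients along one fixed sequence
  of steps. Where \<open>F \<omega>\<close> is not differentiable, \<open>dir_deriv\<close> is an
  arbitrary choice, which is harmless only after completion.\<close>

lemma measurable_dir_deriv:
  fixes F :: "'w \<Rightarrow> 'a::euclidean_space \<Rightarrow> real"
  assumes S: "open S" "x \<in> S"
    and F: "\<And>y. y \<in> S \<Longrightarrow> (\<lambda>\<omega>. F \<omega> y) \<in> borel_measurable (completion P)"
    and diff: "AE \<omega> in P. F \<omega> differentiable (at x)"
  shows "(\<lambda>\<omega>. dir_deriv (F \<omega>) v x) \<in> borel_measurable (completion P)"
proof -
  have "(\<lambda>r. x + r *\<^sub>R v) \<midarrow>0\<rightarrow> x + 0 *\<^sub>R v" by (intro tendsto_intros)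
  then have "eventually (\<lambda>r. x + r *\<^sub>R v \<in> S) (at (0::real))"
    using S by (auto dest: topological_tendstoD)
  then obtain d where d: "0 < d" "\<And>r. r \<noteq> 0 \<Longrightarrow> \<bar>r\<bar> < d \<Longrightarrow> x + r *\<^sub>R v \<in> S"
    by (auto simp: eventually_at dist_real_def)
  \<comment> \<open>The 2 in the denominator keeps the step strictly below \<open>d\<close> already
    at \<open>k = 0\<close>.\<close>
  define h where "h k = d / (2 + real k)" for k :: nat
  have h: "0 < h k" "h k < d" for k using d(1) by (auto simp: h_def field_simps add_pos_nonneg)
  have "h \<longlonglongrightarrow> 0" unfolding h_def by real_asymp
  then have h0: "filterlim h (at 0) sequentially"
    using h(1) by (auto simp: filterlim_at less_imp_neq[THEN not_sym])
  define G where "G \<omega> = (\<lambda>k. (F \<omega> (x + h k *\<^sub>R v) - F \<omega> x) / h k)" for \<omega>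
  have "(\<lambda>\<omega>. lim (G \<omega>)) \<in> borel_measurable (completion P)"
  proof (rule borel_measurable_lim_metric)
    show "(\<lambda>\<omega>. G \<omega> k) \<in> borel_measurable (completion P)" for k
      unfolding G_def using F S(2) d(2)[of "h k"] h[of k] by (intro borel_measurable_divide borel_measurable_diff) auto
  qed
  moreover have "AE \<omega> in P. lim (G \<omega>) = dir_deriv (F \<omega>) v x"
    using diff
  proof eventually_elim
    case (elim \<omega>)
    let ?f' = "frechet_derivative (F \<omega>) (at x)"
    have f': "(F \<omega> has_derivative ?f') (at (x + 0 *\<^sub>R v))"
      using elim frechet_derivative_works by auto
    have "((\<lambda>r. x + r *\<^sub>R v) has_derivative (\<lambda>k. k *\<^sub>R v)) (at 0)"
      by (auto intro!: derivative_eq_intros)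
    from has_derivative_compose[OF this f']
    have "((\<lambda>r. F \<omega> (x + r *\<^sub>R v)) has_derivative (\<lambda>k. ?f' (k *\<^sub>R v))) (at 0)" .
    moreover have "?f' (k *\<^sub>R v) = ?f' v * k" for k
      using linear_frechet_derivative[OF elim] by (simp add: linear_cmul)
    ultimately have "((\<lambda>r. F \<omega> (x + r *\<^sub>R v)) has_field_derivative ?f' v) (at 0)"
      by (simp add: has_field_derivative_def)
    then have "(\<lambda>r. (F \<omega> (x + r *\<^sub>R v) - F \<omega> x) / r) \<midarrow>0\<rightarrow> ?f' v"
      by (simp add: has_field_derivative_iff)
    from filterlim_compose[OF this h0] have "G \<omega> \<longlonglongrightarrow> ?f' v"
      by (simp add: G_def)
    then show ?case by (simp add: limI dir_deriv_def)
  qed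
  ultimately show ?thesis by (rule measurable_completion_AE_cong)
qed

lemma borel_measurable_vec_nth:
  fixes f :: "'w \<Rightarrow> 'b::euclidean_space ^ 'n"
  assumes "\<And>i. (\<lambda>\<omega>. f \<omega> $ i) \<in> borel_measurable M"
  shows "f \<in> borel_measurable M"
proof (subst borel_measurable_euclidean_space, intro ballI)
  fix b :: "'b ^ 'n" assume "b \<in> Basis"
  then obtain i c where "b = axis i c" by (auto simp: Basis_vec_def)
  then show "(\<lambda>\<omega>. f \<omega> \<bullet> b) \<in> borel_measurable M"
    using assms by (auto simp: inner_axis intro!: borel_measurable_inner)
qed

section \<open>Tail bounds and convergence of moments\<close>

text \<open>Markov's inequality for the power \<open>L\<close>; the moment bound depends on neither
  \<open>r\<close> nor \<open>n\<close>.\<close>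

lemma bounded_moments_tail:
  fixes W :: "nat \<Rightarrow> 'w \<Rightarrow> 'x::{real_normed_vector, second_countable_topology}"
  assumes P: "prob_space P" and W: "\<And>n. W n \<in> borel_measurable P"
    and bdd: "bounded_moments P (\<lambda>n \<omega>. norm (W n \<omega>))" and L: "0 < L"
  shows "(SUP r\<in>{0<..}. SUP n. ennreal (r powr L * measure P {\<omega> \<in> space P. norm (W n \<omega>) \<ge> r})) < \<infinity>"
proof -
  interpret prob_space P by fact
  note [measurable] = W
  obtain B where B: "0 \<le> B" "\<And>n. (\<integral>\<^sup>+\<omega>. ennreal (norm (W n \<omega>) powr L) \<partial>P) \<le> ennreal B"
    using bounded_moments_bound[OF bdd L] by blast
  have "ennreal (r powr L * measure P {\<omega> \<in> space P. norm (W n \<omega>) \<ge> r}) \<le> ennreal B" if "0 < r" for r n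
  proof -
    let ?S = "{\<omega> \<in> space P. norm (W n \<omega>) \<ge> r}"
    have "ennreal (r powr L * measure P ?S) = ennreal (r powr L) * emeasure P ?S"
      by (simp add: ennreal_mult emeasure_eq_measure)
    also have "\<dots> = (\<integral>\<^sup>+\<omega>. ennreal (r powr L) * indicator ?S \<omega> \<partial>P)"
      by (subst nn_integral_cmult_indicator) auto
    also have "\<dots> \<le> (\<integral>\<^sup>+\<omega>. ennreal (norm (W n \<omega>) powr L) \<partial>P)"
      using that L by (intro nn_integral_mono) (auto simp: indicator_def intro!: ennreal_leI powr_mono2)
    finally show ?thesis using B(2) by (rule order_trans)
  qed
  then have "(SUP r\<in>{0<..}. SUP n. ennreal (r powr L * measure P {\<omega> \<in> space P. norm (W n \<omega>) \<ge> r})) \<le> ennreal B"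
    by (intro SUP_least) auto
  then show ?thesis by (rule order_le_less_trans) simp
qed

text \<open>Clamping, as opposed to cutting off to 0, keeps the function continuous, so its
  composition with \<open>f\<close> is an admissible test function in
  \<open>conv_in_law\<close>.\<close>

definition truncate :: "real \<Rightarrow> real \<Rightarrow> real" where
  "truncate N y = max (- N) (min N y)"

text \<open>Clamping at \<open>N\<close> changes \<open>y\<close> by at most
  \<open>y\<^sup>2 / N\<close>, so a second moment bound gives uniform integrability in quantitative
  form.\<close>

lemma truncation_error:
  assumes P: "prob_space P" and g: "g \<in> borel_measurable P" and N: "0 < N"
    and B: "0 \<le> B" "(\<integral>\<^sup>+\<omega>. ennreal ((g \<omega>)\<^sup>2) \<partial>P) \<le> ennreal B"
  shows "integrable P g" "\<bar>(\<integral>\<omega>. g \<omega> \<partial>P) - (\<integral>\<omega>. truncate N (g \<omega>) \<partial>P)\<bar> \<le> B / N"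
proof -
  interpret prob_space P by fact
  note [measurable] = g
  have "(\<integral>\<^sup>+\<omega>. ennreal ((g \<omega>)\<^sup>2) \<partial>P) < \<infinity>" using B(2) by (rule order_le_less_trans) simp
  then have sq: "integrable P (\<lambda>\<omega>. (g \<omega>)\<^sup>2)"
    by (intro integrableI_nonneg) auto
  have sqB: "(\<integral>\<omega>. (g \<omega>)\<^sup>2 \<partial>P) \<le> B"
    using B nn_integral_eq_integral[OF sq] by simp
  have "integrable P (\<lambda>\<omega>. 1 + (g \<omega>)\<^sup>2)" using sq by simp
  then show g_int: "integrable P g"
  proof (rule Bochner_Integration.integrable_bound)
    have "\<bar>y\<bar> \<le> 1 + y\<^sup>2" for y :: real
      using zero_le_power2[of "\<bar>y\<bar> - 1"] by (simp add: power2_eq_square algebra_simps)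
    then show "AE \<omega> in P. norm (g \<omega>) \<le> norm (1 + (g \<omega>)\<^sup>2)" by simp
  qed measurable
  have trunc: "\<bar>y - truncate N y\<bar> \<le> y\<^sup>2 / N" for y
  proof (cases "\<bar>y\<bar> \<le> N")
    case True
    then have "truncate N y = y" by (auto simp: truncate_def)
    then show ?thesis using N by simp
  next
    case False
    have "\<bar>y - truncate N y\<bar> \<le> \<bar>y\<bar>" using N by (auto simp: truncate_def)
    also have "\<dots> \<le> y\<^sup>2 / N"
      using False N mult_left_mono[of N "\<bar>y\<bar>" "\<bar>y\<bar>"] by (simp add: pos_le_divide_eq power2_eq_square)
    finally show ?thesis .
  qed
  have t_int: "integrable P (\<lambda>\<omega>. truncate N (g \<omega>))"
    by (rule Bochner_Integration.integrable_bound[OF g_int]) (use N in \<open>auto simp: truncate_def\<close>)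
  have "\<bar>(\<integral>\<omega>. g \<omega> \<partial>P) - (\<integral>\<omega>. truncate N (g \<omega>) \<partial>P)\<bar> = \<bar>\<integral>\<omega>. g \<omega> - truncate N (g \<omega>) \<partial>P\<bar>"
    using g_int t_int by simp
  also have "\<dots> \<le> (\<integral>\<omega>. \<bar>g \<omega> - truncate N (g \<omega>)\<bar> \<partial>P)" by (rule integral_abs_bound)
  also have "\<dots> \<le> (\<integral>\<omega>. (g \<omega>)\<^sup>2 / N \<partial>P)"
    using g_int t_int sq trunc by (intro integral_mono) auto
  also have "\<dots> \<le> B / N" using sqB N by (simp add: divide_right_mono)
  finally show "\<bar>(\<integral>\<omega>. g \<omega> \<partial>P) - (\<integral>\<omega>. truncate N (g \<omega>) \<partial>P)\<bar> \<le> B / N" .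
qed

text \<open>Polynomial growth gives a bound \<open>B\<close> on the second moments of
  \<open>f (W n \<omega>)\<close> uniformly in \<open>n\<close>, so truncation costs at most
  \<open>B / N\<close> for all \<open>n\<close> at once; convergence in law applies to the truncated
  functions.\<close>

lemma convergence_of_moments:
  fixes W :: "nat \<Rightarrow> 'w \<Rightarrow> 'x::{real_normed_vector, second_countable_topology}"
    and f :: "'x \<Rightarrow> real"
  assumes P: "prob_space P" and W: "\<And>n. W n \<in> borel_measurable P"
    and bdd: "bounded_moments P (\<lambda>n \<omega>. norm (W n \<omega>))"
    and Q: "prob_space Q" and Y: "Y \<in> borel_measurable Q"
    and law: "conv_in_law P W Q Y"
    and f: "continuous_on UNIV f" "poly_growth f"
  shows "integrable P (\<lambda>\<omega>. f (W n \<omega>))" "integrable Q (\<lambda>z. f (Y z))"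
    "(\<lambda>n. \<integral>\<omega>. f (W n \<omega>) \<partial>P) \<longlonglongrightarrow> (\<integral>z. f (Y z) \<partial>Q)"
proof -
  interpret P: prob_space P by fact
  interpret Q: prob_space Q by fact
  note [measurable] = W Y borel_measurable_continuous_onI[OF f(1)]
  obtain C k where C: "\<And>x. \<bar>f x\<bar> \<le> C * (1 + norm x) ^ k"
    using f(2) unfolding poly_growth_def by blast
  have C0: "0 \<le> C" using C[of 0] by simp
  have "bounded_moments P (\<lambda>n \<omega>. \<bar>f (W n \<omega>)\<bar>)"
  \<comment> \<open>The exponent is \<open>real k + 1\<close> because \<open>k\<close> may be 0
    while \<open>bounded_moments_powr\<close> asks for a positive exponent.\<close>
  proof (rule bounded_moments_dominated[where c = C and Z = "\<lambda>n \<omega>. (1 + norm (W n \<omega>)) powr (real k + 1)"])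
    show "bounded_moments P (\<lambda>n \<omega>. (1 + norm (W n \<omega>)) powr (real k + 1))"
      by (intro bounded_moments_powr bounded_moments_add bounded_moments_const P bdd) auto
    have "\<bar>f x\<bar> \<le> C * (1 + norm x) powr (real k + 1)" for x
    proof -
      have "(1 + norm x) ^ k = (1 + norm x) powr real k"
        by (rule powr_realpow[symmetric]) (simp add: add_pos_nonneg)
      also have "\<dots> \<le> (1 + norm x) powr (real k + 1)" by (intro powr_mono) auto
      finally show ?thesis using C[of x] C0 by (meson mult_left_mono order_trans)
    qed
    then show "AE \<omega> in P. \<bar>f (W n \<omega>)\<bar> \<le> C * (1 + norm (W n \<omega>)) powr (real k + 1)" for n by simp
  qed (use C0 in auto)
  from bounded_moments_bound[OF this, of 2]
  obtain B where B: "0 \<le> B" "\<And>n. (\<integral>\<^sup>+\<omega>. ennreal ((f (W n \<omega>))\<^sup>2) \<partial>P) \<le> ennreal B"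
    by auto
  have cont_bdd: "(\<lambda>n. \<integral>\<omega>. h (f (W n \<omega>)) \<partial>P) \<longlonglongrightarrow> (\<integral>z. h (f (Y z)) \<partial>Q)"
    if "continuous_on UNIV h" "bounded (range h)" for h :: "real \<Rightarrow> real"
  proof -
    have "continuous_on UNIV (\<lambda>x. h (f x))"
      using continuous_on_compose2[OF that(1) f(1)] by simp
    moreover have "bounded (range (\<lambda>x. h (f x)))"
      by (rule bounded_subset[OF that(2)]) auto
    ultimately show ?thesis using law by (auto simp: conv_in_law_def)
  qed
  \<comment> \<open>The limit inherits the bound \<open>B\<close>: each
    \<open>min N (y\<^sup>2)\<close> is bounded and continuous in \<open>y\<close>, so its integral
    passes to the limit in law, and monotone convergence lets \<open>N\<close> grow.\<close>
  have QB: "(\<integral>\<^sup>+z. ennreal ((f (Y z))\<^sup>2) \<partial>Q) \<le> ennreal B"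
  proof (rule LIMSEQ_le_const2)
    show "(\<lambda>N. \<integral>\<^sup>+z. ennreal (min (real N) ((f (Y z))\<^sup>2)) \<partial>Q) \<longlonglongrightarrow> (\<integral>\<^sup>+z. ennreal ((f (Y z))\<^sup>2) \<partial>Q)"
    proof (rule nn_integral_LIMSEQ)
      show "incseq (\<lambda>N z. ennreal (min (real N) ((f (Y z))\<^sup>2)))"
        by (auto simp: incseq_def le_fun_def intro!: ennreal_leI)
      show "(\<lambda>N. ennreal (min (real N) ((f (Y z))\<^sup>2))) \<longlonglongrightarrow> ennreal ((f (Y z))\<^sup>2)" for z
      proof (rule tendsto_eventually)
        obtain N0 :: nat where "(f (Y z))\<^sup>2 \<le> real N0" using real_arch_simple by blast
        then show "\<forall>\<^sub>F N in sequentially. ennreal (min (real N) ((f (Y z))\<^sup>2)) = ennreal ((f (Y z))\<^sup>2)"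
          by (intro eventually_sequentiallyI[of N0]) (simp add: min_absorb2)
      qed
    qed measurable
    have "(\<integral>\<^sup>+z. ennreal (min (real N) ((f (Y z))\<^sup>2)) \<partial>Q) \<le> ennreal B" for N
    proof -
      have int: "integrable M (\<lambda>x. min (real N) ((g x)\<^sup>2))"
        if "prob_space M" "g \<in> borel_measurable M" for M :: "'c measure" and g
      proof -
        interpret prob_space M by fact
        show ?thesis using that(2) by (intro integrable_const_bound[of _ "real N"]) auto
      qed
      have "(\<integral>z. min (real N) ((f (Y z))\<^sup>2) \<partial>Q) \<le> B"
      proof (rule LIMSEQ_le_const2)
        show "(\<lambda>n. \<integral>\<omega>. min (real N) ((f (W n \<omega>))\<^sup>2) \<partial>P) \<longlonglongrightarrow> (\<integral>z. min (real N) ((f (Y z))\<^sup>2) \<partial>Q)"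
          by (rule cont_bdd) (auto intro!: continuous_intros boundedI[of _ "real N"])
        have "(\<integral>\<omega>. min (real N) ((f (W n \<omega>))\<^sup>2) \<partial>P) \<le> B" for n
        proof -
          have "ennreal (\<integral>\<omega>. min (real N) ((f (W n \<omega>))\<^sup>2) \<partial>P)
              = (\<integral>\<^sup>+\<omega>. ennreal (min (real N) ((f (W n \<omega>))\<^sup>2)) \<partial>P)"
            by (intro nn_integral_eq_integral[symmetric] int P) auto
          also have "\<dots> \<le> (\<integral>\<^sup>+\<omega>. ennreal ((f (W n \<omega>))\<^sup>2) \<partial>P)"
            by (intro nn_integral_mono ennreal_leI) simp
          also have "\<dots> \<le> ennreal B" by (rule B)
          finally show ?thesis using B(1) by simp
        qed
        then show "\<exists>n0. \<forall>n\<ge>n0. (\<integral>\<omega>. min (real N) ((f (W n \<omega>))\<^sup>2) \<partial>P) \<le> B" by blast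
      qed
      moreover have "(\<integral>\<^sup>+z. ennreal (min (real N) ((f (Y z))\<^sup>2)) \<partial>Q)
          = ennreal (\<integral>z. min (real N) ((f (Y z))\<^sup>2) \<partial>Q)"
        by (intro nn_integral_eq_integral int Q) auto
      ultimately show ?thesis by (simp add: ennreal_leI)
    qed
    then show "\<exists>N0. \<forall>N\<ge>N0. (\<integral>\<^sup>+z. ennreal (min (real N) ((f (Y z))\<^sup>2)) \<partial>Q) \<le> ennreal B" by blast
  qed
  have PW: "(\<lambda>\<omega>. f (W n \<omega>)) \<in> borel_measurable P" for n by measurable
  have QY: "(\<lambda>z. f (Y z)) \<in> borel_measurable Q" by measurable
  note errP = truncation_error[OF P PW _ B]
  note errQ = truncation_error[OF Q QY _ B(1) QB]
  show "integrable P (\<lambda>\<omega>. f (W n \<omega>))" "integrable Q (\<lambda>z. f (Y z))"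
    using errP(1)[of 1] errQ(1)[of 1] by auto
  show "(\<lambda>n. \<integral>\<omega>. f (W n \<omega>) \<partial>P) \<longlonglongrightarrow> (\<integral>z. f (Y z) \<partial>Q)"
  proof (rule LIMSEQ_I)
    fix e :: real assume e: "0 < e"
    \<comment> \<open>The summand 1 keeps \<open>N\<close> positive when \<open>B = 0\<close> and
      makes \<open>B / N < e / 3\<close> strict.\<close>
    define N where "N = 3 * (B + 1) / e"
    have N: "0 < N" "B / N < e / 3" using e B(1) by (auto simp: N_def field_simps)
    have "(\<lambda>n. \<integral>\<omega>. truncate N (f (W n \<omega>)) \<partial>P) \<longlonglongrightarrow> (\<integral>z. truncate N (f (Y z)) \<partial>Q)"
    proof (rule cont_bdd)
      show "continuous_on UNIV (truncate N)"
        unfolding truncate_def[abs_def] by (intro continuous_intros)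
      show "bounded (range (truncate N))"
        using N by (intro boundedI[of _ N]) (auto simp: truncate_def)
    qed
    then obtain n0 where n0: "\<And>n. n0 \<le> n \<Longrightarrow>
        \<bar>(\<integral>\<omega>. truncate N (f (W n \<omega>)) \<partial>P) - (\<integral>z. truncate N (f (Y z)) \<partial>Q)\<bar> < e / 3"
      using LIMSEQ_D[of _ _ "e / 3"] e by fastforce
    have "\<bar>(\<integral>\<omega>. f (W n \<omega>) \<partial>P) - (\<integral>z. f (Y z) \<partial>Q)\<bar> < e" if "n0 \<le> n" for n
      using n0[OF that] errP(2)[OF N(1), of n] errQ(2)[OF N(1)] N(2) by linarith
    then show "\<exists>no. \<forall>n\<ge>no. norm ((\<integral>\<omega>. f (W n \<omega>) \<partial>P) - (\<integral>z. f (Y z) \<partial>Q)) < e" by auto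
  qed
qed

section \<open>Block expansions and regularity of the contrast\<close>

text \<open>Serves two purposes: carrying bounds on third derivatives from a countable dense set to
  the whole open set, and carrying inequalities between values of the contrast to the
  closure.\<close>

lemma le_on_dense_subset:
  fixes g :: "'a::topological_space \<Rightarrow> real"
  assumes g: "continuous_on S g" and D: "D \<subseteq> S" "S \<subseteq> closure D"
    and le: "\<And>x. x \<in> D \<Longrightarrow> g x \<le> B" and x: "x \<in> S"
  shows "g x \<le> B"
proof -
  have "closedin (top_of_set S) (S \<inter> g -` {..B})"
    using g closed_atMost by (rule continuous_closedin_preimage)
  then obtain U where U: "closed U" "S \<inter> g -` {..B} = S \<inter> U"
    by (auto simp: closedin_closed)
  then have "D \<subseteq> U" using D le by blast
  then have "closure D \<subseteq> U" using U(1) by (rule closure_minimal)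
  then show ?thesis using U(2) x D by blast
qed

lemma sum_axis_Pair:
  "(\<Sum>i\<in>UNIV. c $ i *\<^sub>R (axis i 1 :: real ^ 'n, 0 :: 'b::real_vector)) = (c, 0)"
  "(\<Sum>i\<in>UNIV. c $ i *\<^sub>R (0 :: 'b::real_vector, axis i 1 :: real ^ 'n)) = (0, c)"
proof -
  have "(\<Sum>i\<in>UNIV. c $ i *\<^sub>R (axis i 1 :: real ^ 'n)) = c"
    using basis_expansion[of c] by (simp add: scalar_mult_eq_scaleR)
  then show
    "(\<Sum>i\<in>UNIV. c $ i *\<^sub>R (axis i 1 :: real ^ 'n, 0 :: 'b::real_vector)) = (c, 0)"
    "(\<Sum>i\<in>UNIV. c $ i *\<^sub>R (0 :: 'b::real_vector, axis i 1 :: real ^ 'n)) = (0, c)"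
    by (auto simp: prod_eq_iff fst_sum snd_sum)
qed

lemma Taylor_lower_bound_a:
  fixes f :: "(real ^ 'p) \<times> (real ^ 'q) \<Rightarrow> real"
  assumes f: "Ck_on 3 S f" and S: "convex S" "open S" and x: "(\<alpha>0, \<beta>) \<in> S" "(\<alpha>, \<beta>) \<in> S"
    and D1: "norm (s *\<^sub>R D_a f (\<alpha>0, \<beta>)) \<le> Z"
    and D2: "norm (s\<^sup>2 *\<^sub>R D_aa f (\<alpha>0, \<beta>) - C) \<le> \<rho>"
    and C: "\<And>x. \<mu> * (norm x)\<^sup>2 \<le> x \<bullet> (C *v x)"
    and D3: "\<And>y. y \<in> S \<Longrightarrow> norm (s\<^sup>2 *\<^sub>R D_aaa f y) \<le> Z"
    and s: "0 < s"
  shows "\<mu> / 2 * (norm (\<alpha> - \<alpha>0))\<^sup>2 - s * Z * norm (\<alpha> - \<alpha>0) - \<rho> / 2 * (norm (\<alpha> - \<alpha>0))\<^sup>2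
           - Z / 6 * norm (\<alpha> - \<alpha>0) ^ 3 \<le> s\<^sup>2 * (f (\<alpha>, \<beta>) - f (\<alpha>0, \<beta>))"
  using Taylor_lower_bound[of S f "(\<alpha>0, \<beta>)" "\<alpha> - \<alpha>0" "\<lambda>i. (axis i 1, 0)" s Z C \<rho> \<mu>,
      unfolded sum_axis_Pair]
    assms by (simp add: D_a_def D_aa_def D_aaa_def Da_def)

lemma Taylor_lower_bound_b:
  fixes f :: "(real ^ 'p) \<times> (real ^ 'q) \<Rightarrow> real"
  assumes f: "Ck_on 3 S f" and S: "convex S" "open S" and x: "(\<alpha>, \<beta>0) \<in> S" "(\<alpha>, \<beta>) \<in> S"
    and D1: "norm (s *\<^sub>R D_b f (\<alpha>, \<beta>0)) \<le> Z"
    and D2: "norm (s\<^sup>2 *\<^sub>R D_bb f (\<alpha>, \<beta>0) - C) \<le> \<rho>"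
    and C: "\<And>x. \<mu> * (norm x)\<^sup>2 \<le> x \<bullet> (C *v x)"
    and D3: "\<And>y. y \<in> S \<Longrightarrow> norm (s\<^sup>2 *\<^sub>R D_bbb f y) \<le> Z"
    and s: "0 < s"
  shows "\<mu> / 2 * (norm (\<beta> - \<beta>0))\<^sup>2 - s * Z * norm (\<beta> - \<beta>0) - \<rho> / 2 * (norm (\<beta> - \<beta>0))\<^sup>2
           - Z / 6 * norm (\<beta> - \<beta>0) ^ 3 \<le> s\<^sup>2 * (f (\<alpha>, \<beta>) - f (\<alpha>, \<beta>0))"
  using Taylor_lower_bound[of S f "(\<alpha>, \<beta>0)" "\<beta> - \<beta>0" "\<lambda>i. (0, axis i 1)" s Z C \<rho> \<mu>,
      unfolded sum_axis_Pair]
    assms by (simp add: D_b_def D_bb_def D_bbb_def Db_def)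

lemma continuous_on_third_derivatives:
  assumes "Ck_on 3 S f"
  shows "continuous_on S (D_aaa f)" "continuous_on S (D_bbb f)"
  using Ck_on_3(4)[OF assms]
  by (auto simp: D_aaa_def[abs_def] D_bbb_def[abs_def] Da_def Db_def intro!: continuous_on_vec_lambda)

lemma measurable_derivatives:
  fixes F :: "'w \<Rightarrow> 'a::euclidean_space \<Rightarrow> real"
  assumes S: "open S" "x \<in> S"
    and F: "\<And>y. y \<in> S \<Longrightarrow> (\<lambda>\<omega>. F \<omega> y) \<in> borel_measurable (completion P)"
    and C3: "AE \<omega> in P. Ck_on 3 S (F \<omega>)"
  shows "(\<lambda>\<omega>. dir_deriv (F \<omega>) d x) \<in> borel_measurable (completion P)"
    and "(\<lambda>\<omega>. dir_deriv (dir_deriv (F \<omega>) d) d' x) \<in> borel_measurable (completion P)"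
    and "(\<lambda>\<omega>. dir_deriv (dir_deriv (dir_deriv (F \<omega>) d) d') d'' x) \<in> borel_measurable (completion P)"
proof -
  have 1: "(\<lambda>\<omega>. dir_deriv (F \<omega>) d y) \<in> borel_measurable (completion P)" if "y \<in> S" for y d
    using C3 by (intro measurable_dir_deriv[OF S(1) that F]) (auto elim!: eventually_mono intro: Ck_on_3(1) that)
  have 2: "(\<lambda>\<omega>. dir_deriv (dir_deriv (F \<omega>) d) d' y) \<in> borel_measurable (completion P)" if "y \<in> S" for y d d'
    using C3 by (intro measurable_dir_deriv[OF S(1) that 1]) (auto elim!: eventually_mono intro: Ck_on_3(2) that)
  have 3: "(\<lambda>\<omega>. dir_deriv (dir_deriv (dir_deriv (F \<omega>) d) d') d'' y) \<in> borel_measurable (completion P)"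
    if "y \<in> S" for y d d' d''
    using C3 by (intro measurable_dir_deriv[OF S(1) that 2]) (auto elim!: eventually_mono intro: Ck_on_3(3) that)
  show "(\<lambda>\<omega>. dir_deriv (F \<omega>) d x) \<in> borel_measurable (completion P)"
    "(\<lambda>\<omega>. dir_deriv (dir_deriv (F \<omega>) d) d' x) \<in> borel_measurable (completion P)"
    "(\<lambda>\<omega>. dir_deriv (dir_deriv (dir_deriv (F \<omega>) d) d') d'' x) \<in> borel_measurable (completion P)"
    using 1 2 3 S(2) by auto
qed

lemma measurable_partial_derivatives:
  fixes F :: "'w \<Rightarrow> (real ^ 'p) \<times> (real ^ 'q) \<Rightarrow> real"
  assumes S: "open S" "x \<in> S"
    and F: "\<And>y. y \<in> S \<Longrightarrow> (\<lambda>\<omega>. F \<omega> y) \<in> borel_measurable (completion P)"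
    and C3: "AE \<omega> in P. Ck_on 3 S (F \<omega>)"
  shows "(\<lambda>\<omega>. D_a (F \<omega>) x) \<in> borel_measurable (completion P)"
    and "(\<lambda>\<omega>. D_b (F \<omega>) x) \<in> borel_measurable (completion P)"
    and "(\<lambda>\<omega>. D_aa (F \<omega>) x) \<in> borel_measurable (completion P)"
    and "(\<lambda>\<omega>. D_bb (F \<omega>) x) \<in> borel_measurable (completion P)"
    and "(\<lambda>\<omega>. D_aaa (F \<omega>) x) \<in> borel_measurable (completion P)"
    and "(\<lambda>\<omega>. D_bbb (F \<omega>) x) \<in> borel_measurable (completion P)"
  unfolding D_a_def D_b_def D_aa_def D_bb_def D_aaa_def D_bbb_def Da_def Db_def
  by (intro borel_measurable_vec_nth; simp; intro borel_measurable_vec_nth measurable_derivatives[OF S F C3];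
      simp; intro borel_measurable_vec_nth measurable_derivatives[OF S F C3]; simp;
      intro measurable_derivatives[OF S F C3])+

section \<open>Increments of the penalty\<close>

text \<open>Coordinates that vanish at \<open>x0\<close> can only raise the penalty at
  \<open>x\<close>, so their weights drop out and only the weights \<open>ls\<close> remain in this
  one-sided bound.\<close>

lemma penalty_difference:
  assumes R: "\<And>x. 0 \<le> R x" "R 0 = 0" and lo: "\<And>i. 0 \<le> lo i" and ls: "\<And>j. 0 \<le> ls j"
    and x0: "\<And>i. x0 $ Inl i = 0" and c: "0 \<le> c"
    and lip: "\<And>j. \<bar>R (x $ Inr j) - R (x0 $ Inr j)\<bar> \<le> c * \<bar>x $ Inr j - x0 $ Inr j\<bar>"
  shows "penalty R lo ls x0 - penalty R lo ls x \<le> c * (\<Sum>j\<in>UNIV. ls j) * norm (x - x0)"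
proof -
  have "0 \<le> (\<Sum>i\<in>UNIV. lo i * R (x $ Inl i))" using R lo by (intro sum_nonneg) auto
  then have "penalty R lo ls x0 - penalty R lo ls x
      \<le> (\<Sum>j\<in>UNIV. ls j * R (x0 $ Inr j)) - (\<Sum>j\<in>UNIV. ls j * R (x $ Inr j))"
    by (simp add: penalty_def x0 R(2))
  also have "\<dots> = (\<Sum>j\<in>UNIV. ls j * (R (x0 $ Inr j) - R (x $ Inr j)))"
    by (simp add: sum_subtractf right_diff_distrib)
  also have "\<dots> \<le> (\<Sum>j\<in>UNIV. ls j * (c * norm (x - x0)))"
  proof (intro sum_mono mult_left_mono ls)
    fix j
    have "\<bar>x $ Inr j - x0 $ Inr j\<bar> \<le> norm (x - x0)"
      using component_le_norm_cart[of "x - x0" "Inr j"] by simp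
    then have "c * \<bar>x $ Inr j - x0 $ Inr j\<bar> \<le> c * norm (x - x0)" using c by (rule mult_left_mono)
    then show "R (x0 $ Inr j) - R (x $ Inr j) \<le> c * norm (x - x0)" using lip[of j] by linarith
  qed
  also have "\<dots> = c * (\<Sum>j\<in>UNIV. ls j) * norm (x - x0)"
    by (simp add: sum_distrib_left sum_distrib_right ac_simps)
  finally show ?thesis .
qed

lemma uniform_lipschitz_at_nonzero:
  fixes x0 :: "real ^ ('m::finite + 'k::finite)"
  assumes "\<And>a0. a0 \<noteq> 0 \<Longrightarrow> \<exists>C>0. \<forall>a. \<bar>a\<bar> \<le> k \<longrightarrow> \<bar>R a - R a0\<bar> \<le> C * \<bar>a - a0\<bar>"
    and "\<And>j. x0 $ Inr j \<noteq> 0"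
  obtains c :: real where "0 \<le> c"
    "\<And>j a. \<bar>a\<bar> \<le> k \<Longrightarrow> \<bar>R a - R (x0 $ Inr j)\<bar> \<le> c * \<bar>a - x0 $ Inr j\<bar>"
proof -
  have "\<forall>j. \<exists>C>0. \<forall>a. \<bar>a\<bar> \<le> k \<longrightarrow> \<bar>R a - R (x0 $ Inr j)\<bar> \<le> C * \<bar>a - x0 $ Inr j\<bar>"
    using assms by blast
  then obtain C :: "'k \<Rightarrow> real" where C: "\<And>j. 0 < C j"
    "\<And>j a. \<bar>a\<bar> \<le> k \<Longrightarrow> \<bar>R a - R (x0 $ Inr j)\<bar> \<le> C j * \<bar>a - x0 $ Inr j\<bar>"
    by metis
  show ?thesis
  proof (rule that[of "sum C UNIV"])
    show "0 \<le> sum C UNIV" using C(1) by (intro sum_nonneg) (simp add: less_imp_le)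
    fix j a assume "\<bar>a\<bar> \<le> k"
    then have "\<bar>R a - R (x0 $ Inr j)\<bar> \<le> C j * \<bar>a - x0 $ Inr j\<bar>" by (rule C)
    also have "\<dots> \<le> sum C UNIV * \<bar>a - x0 $ Inr j\<bar>"
      using C(1) by (intro mult_right_mono member_le_sum) (auto simp: less_imp_le)
    finally show "\<bar>R a - R (x0 $ Inr j)\<bar> \<le> sum C UNIV * \<bar>a - x0 $ Inr j\<bar>" .
  qed
qed

section \<open>Estimates at a fixed sample point\<close>

text \<open>Here \<open>x\<close> and \<open>y\<close> are the errors of the two blocks,
  \<open>\<Delta>1\<close> is the increment of the contrast in alpha at the estimated beta, and
  \<open>\<Delta>2\<close> its increment in beta at the true alpha. The rate inequalities enter as
  the hypotheses \<open>bound1\<close> and \<open>bound2\<close>, so their constants are fixed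
  beforehand. \<open>Z'\<close> plays for the second block the part that \<open>Z\<close> plays for
  the first.\<close>

lemma two_step_error_bound:
  fixes s t x y Z D E \<Delta>1 \<Delta>2 :: real
  assumes bound1: "\<And>s x Z. \<lbrakk>0 < s; 0 \<le> x; x \<le> D; 1 \<le> Z;
       \<kappa>a * x\<^sup>2 \<le> s powr (2 * \<delta>1a) * Z + Z * (s\<^sup>2 + s * x);
       \<mu>a / 2 * x\<^sup>2 \<le> Z * (s\<^sup>2 + s * x) + s powr (2 * \<delta>2a) * Z * x\<^sup>2 + Z * x ^ 3\<rbrakk>
     \<Longrightarrow> x / s \<le> Ca * Z powr ma"
    and bound2: "\<And>s x Z. \<lbrakk>0 < s; 0 \<le> x; x \<le> D; 1 \<le> Z;
       \<kappa>b * x\<^sup>2 \<le> s powr (2 * \<delta>1b) * Z + Z * (s\<^sup>2 + s * x);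
       \<mu>b / 2 * x\<^sup>2 \<le> Z * (s\<^sup>2 + s * x) + s powr (2 * \<delta>2b) * Z * x\<^sup>2 + Z * x ^ 3\<rbrakk>
     \<Longrightarrow> x / s \<le> Cb * Z powr mb"
    and s: "0 < s" "s powr (2 * \<delta>2a) \<le> E" and t: "0 < t"
    and x: "0 \<le> x" "x \<le> D" and y: "0 \<le> y" "y \<le> D" and Z: "1 \<le> Z" and \<mu>a: "0 < \<mu>a" and Ca: "0 \<le> Ca"
    and ia: "\<kappa>a * x\<^sup>2 - s powr (2 * \<delta>1a) * Z \<le> s\<^sup>2 * \<Delta>1"
    and iia: "\<mu>a / 2 * x\<^sup>2 - s * Z * x - s powr (2 * \<delta>2a) * Z / 2 * x\<^sup>2 - Z / 6 * x ^ 3 \<le> s\<^sup>2 * \<Delta>1"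
    and ib: "\<kappa>b * y\<^sup>2 - t powr (2 * \<delta>1b) * Z \<le> t\<^sup>2 * \<Delta>2"
    and iib: "\<mu>b / 2 * y\<^sup>2 - t * Z * y - t powr (2 * \<delta>2b) * Z / 2 * y\<^sup>2 - Z / 6 * y ^ 3 \<le> t\<^sup>2 * \<Delta>2"
    and opt1: "\<Delta>1 \<le> Z * (x / s)"
    and opt2: "\<Delta>1 + \<Delta>2 \<le> Z * (x / s) + Z * (y / t)"
  defines "U \<equiv> Ca * (2 * Z) powr ma"
  defines "Z' \<equiv> Z + 2 * (Z * U) + (E + D) * (Z * (U * U))"
  shows "x / s + y / t \<le> U + Cb * (2 * Z') powr mb"
proof -
  have pw: "0 \<le> s powr (2 * \<delta>1a)" "0 \<le> s powr (2 * \<delta>2a)" "0 \<le> t powr (2 * \<delta>1b)" "0 \<le> t powr (2 * \<delta>2b)"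
    by auto
  have nn: "0 \<le> s * x * Z" "0 \<le> s\<^sup>2 * Z" "0 \<le> x\<^sup>2 * Z" "0 \<le> x ^ 3 * Z"
    "0 \<le> s powr (2 * \<delta>1a) * Z" "0 \<le> s powr (2 * \<delta>2a) * Z * x\<^sup>2"
    using s x Z by auto
  have "s\<^sup>2 * \<Delta>1 \<le> s\<^sup>2 * (Z * (x / s))" using opt1 by (intro mult_left_mono) auto
  also have "\<dots> = s * x * Z" using s by (simp add: power2_eq_square)
  finally have up: "s\<^sup>2 * \<Delta>1 \<le> s * x * Z" .
  have xU: "x / s \<le> U"
    unfolding U_def
  proof (rule bound1[OF s(1) x])
    \<comment> \<open>The linear term \<open>s * x * Z\<close> occurs twice, from the gradient and
      from the penalty; hence the argument \<open>2 * Z\<close>.\<close>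
    show "1 \<le> 2 * Z" using Z by simp
    show "\<kappa>a * x\<^sup>2 \<le> s powr (2 * \<delta>1a) * (2 * Z) + 2 * Z * (s\<^sup>2 + s * x)"
      using ia up nn by (simp add: algebra_simps)
    show "\<mu>a / 2 * x\<^sup>2 \<le> 2 * Z * (s\<^sup>2 + s * x) + s powr (2 * \<delta>2a) * (2 * Z) * x\<^sup>2 + 2 * Z * x ^ 3"
      using iia up nn by (simp add: algebra_simps)
  qed
  define r where "r = x / s"
  have r: "0 \<le> r" "r \<le> U" "x = s * r" using s x xU by (auto simp: r_def)
  have D: "0 \<le> D" using x by linarith
  have rr: "r * r \<le> U * U" using r by (intro mult_mono) auto
  have ZUU: "0 \<le> Z * (U * U)" using Z by auto
  \<comment> \<open>With \<open>x = s * r\<close> every error term of \<open>iia\<close> has a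
    factor \<open>s\<^sup>2\<close>, which cancels. What is left is polynomial in \<open>Z\<close>
    and \<open>U\<close>, since the remaining factors \<open>s powr (2 * \<delta>2a)\<close> and
    \<open>x\<close> are bounded by \<open>E\<close> and \<open>D\<close>.\<close>
  have lower: "- (Z * U + (E + D) * (Z * (U * U))) \<le> \<Delta>1"
  proof -
    have "s\<^sup>2 * (Z * r) + s\<^sup>2 * (s powr (2 * \<delta>2a) * (Z * (r * r))) + s\<^sup>2 * (x * (Z * (r * r)))
       = s * x * Z + s powr (2 * \<delta>2a) * Z * x\<^sup>2 + Z * x ^ 3"
      unfolding r(3) by (simp add: power2_eq_square power3_eq_cube)
    moreover have "0 \<le> \<mu>a / 2 * x\<^sup>2" using \<mu>a by simp
    ultimately have "s\<^sup>2 * - \<Delta>1 \<le> s\<^sup>2 * (Z * r + s powr (2 * \<delta>2a) * (Z * (r * r)) + x * (Z * (r * r)))"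
      using iia nn by (simp add: algebra_simps)
    then have "- \<Delta>1 \<le> Z * r + s powr (2 * \<delta>2a) * (Z * (r * r)) + x * (Z * (r * r))"
      using s by (simp only: mult_le_cancel_left_pos zero_less_power)
    also have "\<dots> \<le> Z * U + E * (Z * (U * U)) + D * (Z * (U * U))"
      using r rr s x D Z pw by (intro add_mono mult_mono order_trans[OF pw(2) s(2)]) (auto intro: order_trans)
    finally show ?thesis by (simp add: algebra_simps)
  qed
  have "0 \<le> Z * r" using Z r by simp
  have ZU: "0 \<le> Z * U" "Z * r \<le> Z * U" using Z r by (auto intro: mult_left_mono)
  have ED: "0 \<le> (E + D) * (Z * (U * U))"
    using ZUU order_trans[OF pw(2) s(2)] order_trans[OF x] by simp
  have Z': "Z \<le> Z'" using ZU ED by (simp add: Z'_def)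
  define q where "q = y / t"
  have q: "0 \<le> q" "y = t * q" using t y by (auto simp: q_def)
  \<comment> \<open>One \<open>Z * U\<close> is the penalty increment of the first block, the other
    comes from \<open>lower\<close>; together they account for the factor 2 in
    \<open>Z'\<close>.\<close>
  have "\<Delta>2 \<le> Z * U + Z * q + (Z * U + (E + D) * (Z * (U * U)))"
    using opt2 lower ZU unfolding r_def[symmetric] q_def[symmetric] by linarith
  also have "\<dots> \<le> Z' + Z' * q"
    using mult_right_mono[OF Z' q(1)] Z by (simp add: Z'_def)
  finally have "t\<^sup>2 * \<Delta>2 \<le> t\<^sup>2 * (Z' + Z' * q)" by (intro mult_left_mono) auto
  also have "\<dots> = Z' * (t\<^sup>2 + t * y)" unfolding q(2) by (simp add: algebra_simps power2_eq_square)
  finally have up2: "t\<^sup>2 * \<Delta>2 \<le> Z' * (t\<^sup>2 + t * y)" .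
  have nn2: "0 \<le> t * y * Z" "t * y * Z \<le> t * y * Z'" "t powr (2 * \<delta>1b) * Z \<le> t powr (2 * \<delta>1b) * Z'"
    "0 \<le> t powr (2 * \<delta>1b) * Z" "0 \<le> t powr (2 * \<delta>2b) * Z * y\<^sup>2"
    "t powr (2 * \<delta>2b) * Z * y\<^sup>2 \<le> t powr (2 * \<delta>2b) * Z' * y\<^sup>2"
    "0 \<le> Z * y ^ 3" "Z * y ^ 3 \<le> Z' * y ^ 3" "0 \<le> t\<^sup>2 * Z'"
    using t y Z Z' by (auto intro!: mult_left_mono mult_right_mono)
  have "y / t \<le> Cb * (2 * Z') powr mb"
  proof (rule bound2[OF t y])
    show "1 \<le> 2 * Z'" using Z Z' by simp
    show "\<kappa>b * y\<^sup>2 \<le> t powr (2 * \<delta>1b) * (2 * Z') + 2 * Z' * (t\<^sup>2 + t * y)"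
      using ib up2 nn2 by (simp add: algebra_simps)
    show "\<mu>b / 2 * y\<^sup>2 \<le> 2 * Z' * (t\<^sup>2 + t * y) + t powr (2 * \<delta>2b) * (2 * Z') * y\<^sup>2 + 2 * Z' * y ^ 3"
      using iib up2 nn2 by (simp add: algebra_simps)
  qed
  with xU show ?thesis by simp
qed

text \<open>The limit matrices \<open>Ca \<beta>\<close> carry no continuity in beta, so closure is
  not taken in the hypotheses. Instead the inequalities are derived at points of the dense sets,
  where only values of \<open>f\<close> and norms remain, and then extended to \<open>a\<close> and
  \<open>b\<close>, which may lie on the boundary.\<close>

lemma contrast_lower_bounds:
  fixes f :: "(real ^ 'p) \<times> (real ^ 'q) \<Rightarrow> real"
  assumes open_convex: "open (\<Theta>a \<times> \<Theta>b)" "convex (\<Theta>a \<times> \<Theta>b)" and \<theta>0: "\<alpha>0 \<in> \<Theta>a" "\<beta>0 \<in> \<Theta>b"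
    and D: "Xa \<subseteq> \<Theta>a" "\<Theta>a \<subseteq> closure Xa" "Xb \<subseteq> \<Theta>b" "\<Theta>b \<subseteq> closure Xb"
    and f: "continuous_on (closure (\<Theta>a \<times> \<Theta>b)) f" "Ck_on 3 (\<Theta>a \<times> \<Theta>b) f"
    and st: "0 < s" "0 < t"
    and A1a: "\<And>\<alpha> \<beta>. \<lbrakk>\<alpha> \<in> Xa; \<beta> \<in> Xb\<rbrakk> \<Longrightarrow>
          \<kappa>a * (norm (\<alpha> - \<alpha>0))\<^sup>2 - \<rho>1a \<le> s\<^sup>2 * (f (\<alpha>, \<beta>) - f (\<alpha>0, \<beta>))"
    and A1b: "\<And>\<beta>. \<beta> \<in> Xb \<Longrightarrow>
          \<kappa>b * (norm (\<beta> - \<beta>0))\<^sup>2 - \<rho>1b \<le> t\<^sup>2 * (f (\<alpha>0, \<beta>) - f (\<alpha>0, \<beta>0))"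
    and A2a: "\<And>\<beta>. \<beta> \<in> Xb \<Longrightarrow> norm (s\<^sup>2 *\<^sub>R D_aa f (\<alpha>0, \<beta>) - Ca \<beta>) \<le> \<rho>2a"
    and A2b: "norm (t\<^sup>2 *\<^sub>R D_bb f (\<alpha>0, \<beta>0) - Cb) \<le> \<rho>2b"
    and Ca: "\<And>\<beta> x. \<beta> \<in> Xb \<Longrightarrow> \<mu>a * (norm x)\<^sup>2 \<le> x \<bullet> (Ca \<beta> *v x)"
    and Cb: "\<And>x. \<mu>b * (norm x)\<^sup>2 \<le> x \<bullet> (Cb *v x)"
    and A3a: "\<And>\<beta>. \<beta> \<in> Xb \<Longrightarrow> norm (s *\<^sub>R D_a f (\<alpha>0, \<beta>)) \<le> Z"
    and A3b: "norm (t *\<^sub>R D_b f (\<alpha>0, \<beta>0)) \<le> Z"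
    and A3c: "\<And>\<theta>. \<theta> \<in> Xa \<times> Xb \<Longrightarrow> norm (s\<^sup>2 *\<^sub>R D_aaa f \<theta>) \<le> Z"
    and A3d: "\<And>\<theta>. \<theta> \<in> Xa \<times> Xb \<Longrightarrow> norm (t\<^sup>2 *\<^sub>R D_bbb f \<theta>) \<le> Z"
    and ab: "a \<in> closure \<Theta>a" "b \<in> closure \<Theta>b"
  shows "\<kappa>a * (norm (a - \<alpha>0))\<^sup>2 - \<rho>1a \<le> s\<^sup>2 * (f (a, b) - f (\<alpha>0, b))"
    and "\<mu>a / 2 * (norm (a - \<alpha>0))\<^sup>2 - s * Z * norm (a - \<alpha>0) - \<rho>2a / 2 * (norm (a - \<alpha>0))\<^sup>2
           - Z / 6 * norm (a - \<alpha>0) ^ 3 \<le> s\<^sup>2 * (f (a, b) - f (\<alpha>0, b))"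
    and "\<kappa>b * (norm (b - \<beta>0))\<^sup>2 - \<rho>1b \<le> t\<^sup>2 * (f (\<alpha>0, b) - f (\<alpha>0, \<beta>0))"
    and "\<mu>b / 2 * (norm (b - \<beta>0))\<^sup>2 - t * Z * norm (b - \<beta>0) - \<rho>2b / 2 * (norm (b - \<beta>0))\<^sup>2
           - Z / 6 * norm (b - \<beta>0) ^ 3 \<le> t\<^sup>2 * (f (\<alpha>0, b) - f (\<alpha>0, \<beta>0))"
proof -
  let ?S = "\<Theta>a \<times> \<Theta>b"
  have cl: "closure ?S = closure \<Theta>a \<times> closure \<Theta>b" by (rule closure_Times)
  have base: "\<alpha>0 \<in> closure \<Theta>a" using \<theta>0 closure_subset by blast
  have D': "Xa \<times> Xb \<subseteq> ?S" "?S \<subseteq> closure (Xa \<times> Xb)" "Xa \<times> Xb \<subseteq> closure ?S"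
    using Sigma_mono[OF D(1,3)] Sigma_mono[OF D(2,4)] closure_subset[of ?S]
    by (simp_all only: closure_Times)
  have D'': "closure ?S \<subseteq> closure (Xa \<times> Xb)" using D'(2) by (rule closure_minimal) simp
  have Xb': "Xb \<subseteq> closure \<Theta>b" "closure \<Theta>b \<subseteq> closure Xb"
    using D(3) closure_subset[of \<Theta>b] closure_minimal[OF D(4)] by auto
  \<comment> \<open>The Taylor remainder is evaluated at an unknown intermediate point, so the bound
    on third derivatives must hold on all of the open set and not just on the dense part.\<close>
  have third_a: "norm (s\<^sup>2 *\<^sub>R D_aaa f y) \<le> Z" if "y \<in> ?S" for y
    by (rule le_on_dense_subset[OF _ D'(1,2) A3c that])
       (intro continuous_on_norm continuous_on_scaleR continuous_on_const continuous_on_third_derivatives f(2))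
  have third_b: "norm (t\<^sup>2 *\<^sub>R D_bbb f y) \<le> Z" if "y \<in> ?S" for y
    by (rule le_on_dense_subset[OF _ D'(1,2) A3d that])
       (intro continuous_on_norm continuous_on_scaleR continuous_on_const continuous_on_third_derivatives f(2))
  have cont: "continuous_on (closure ?S) (\<lambda>\<theta>. f (fst \<theta>, snd \<theta>))"
    "continuous_on (closure ?S) (\<lambda>\<theta>. f (\<alpha>0, snd \<theta>))"
    "continuous_on (closure \<Theta>b) (\<lambda>\<beta>. f (\<alpha>0, \<beta>))"
    using base f(1) by (auto intro!: continuous_on_compose2[OF f(1)] continuous_intros simp: cl)
  have ab_cl: "(a, b) \<in> closure ?S" using ab by (simp add: cl)
  have dense_1a: "\<kappa>a * (norm (fst \<theta> - \<alpha>0))\<^sup>2 - s\<^sup>2 * (f (fst \<theta>, snd \<theta>) - f (\<alpha>0, snd \<theta>)) \<le> \<rho>1a"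
    if "\<theta> \<in> Xa \<times> Xb" for \<theta>
    using A1a[of "fst \<theta>" "snd \<theta>"] that by (simp add: mem_Times_iff)
  have "\<kappa>a * (norm (fst \<theta> - \<alpha>0))\<^sup>2 - s\<^sup>2 * (f (fst \<theta>, snd \<theta>) - f (\<alpha>0, snd \<theta>)) \<le> \<rho>1a"
    if "\<theta> \<in> closure ?S" for \<theta>
    by (rule le_on_dense_subset[OF _ D'(3) D'' dense_1a that]) (intro continuous_intros cont)
  from this[OF ab_cl]
  show "\<kappa>a * (norm (a - \<alpha>0))\<^sup>2 - \<rho>1a \<le> s\<^sup>2 * (f (a, b) - f (\<alpha>0, b))" by simp
  have "\<mu>a / 2 * (norm (\<alpha> - \<alpha>0))\<^sup>2 - s * Z * norm (\<alpha> - \<alpha>0) - \<rho>2a / 2 * (norm (\<alpha> - \<alpha>0))\<^sup>2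
           - Z / 6 * norm (\<alpha> - \<alpha>0) ^ 3 - s\<^sup>2 * (f (\<alpha>, \<beta>) - f (\<alpha>0, \<beta>)) \<le> 0"
    if "\<alpha> \<in> Xa" "\<beta> \<in> Xb" for \<alpha> \<beta>
  proof -
    have "(\<alpha>0, \<beta>) \<in> ?S" "(\<alpha>, \<beta>) \<in> ?S" using that D \<theta>0 by auto
    from Taylor_lower_bound_a[OF f(2) open_convex(2,1) this A3a[OF that(2)] A2a[OF that(2)]
        Ca[OF that(2)] third_a st(1)]
    show ?thesis by simp
  qed
  then have dense_a: "\<mu>a / 2 * (norm (fst \<theta> - \<alpha>0))\<^sup>2 - s * Z * norm (fst \<theta> - \<alpha>0) - \<rho>2a / 2 * (norm (fst \<theta> - \<alpha>0))\<^sup>2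
           - Z / 6 * norm (fst \<theta> - \<alpha>0) ^ 3 - s\<^sup>2 * (f (fst \<theta>, snd \<theta>) - f (\<alpha>0, snd \<theta>)) \<le> 0"
    if "\<theta> \<in> Xa \<times> Xb" for \<theta>
    using that by (cases \<theta>) simp
  have "\<mu>a / 2 * (norm (fst \<theta> - \<alpha>0))\<^sup>2 - s * Z * norm (fst \<theta> - \<alpha>0) - \<rho>2a / 2 * (norm (fst \<theta> - \<alpha>0))\<^sup>2
           - Z / 6 * norm (fst \<theta> - \<alpha>0) ^ 3 - s\<^sup>2 * (f (fst \<theta>, snd \<theta>) - f (\<alpha>0, snd \<theta>)) \<le> 0"
    if "\<theta> \<in> closure ?S" for \<theta>
    by (rule le_on_dense_subset[OF _ D'(3) D'' dense_a that]) (intro continuous_intros cont)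
  from this[OF ab_cl]
  show "\<mu>a / 2 * (norm (a - \<alpha>0))\<^sup>2 - s * Z * norm (a - \<alpha>0) - \<rho>2a / 2 * (norm (a - \<alpha>0))\<^sup>2
           - Z / 6 * norm (a - \<alpha>0) ^ 3 \<le> s\<^sup>2 * (f (a, b) - f (\<alpha>0, b))" by simp
  have dense_1b: "\<kappa>b * (norm (\<beta> - \<beta>0))\<^sup>2 - t\<^sup>2 * (f (\<alpha>0, \<beta>) - f (\<alpha>0, \<beta>0)) \<le> \<rho>1b"
    if "\<beta> \<in> Xb" for \<beta>
    using A1b[OF that] by simp
  have "\<kappa>b * (norm (b - \<beta>0))\<^sup>2 - t\<^sup>2 * (f (\<alpha>0, b) - f (\<alpha>0, \<beta>0)) \<le> \<rho>1b"
    by (rule le_on_dense_subset[OF _ Xb' dense_1b ab(2)]) (intro continuous_intros cont)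
  then show "\<kappa>b * (norm (b - \<beta>0))\<^sup>2 - \<rho>1b \<le> t\<^sup>2 * (f (\<alpha>0, b) - f (\<alpha>0, \<beta>0))" by simp
  have dense_b: "\<mu>b / 2 * (norm (\<beta> - \<beta>0))\<^sup>2 - t * Z * norm (\<beta> - \<beta>0) - \<rho>2b / 2 * (norm (\<beta> - \<beta>0))\<^sup>2
           - Z / 6 * norm (\<beta> - \<beta>0) ^ 3 - t\<^sup>2 * (f (\<alpha>0, \<beta>) - f (\<alpha>0, \<beta>0)) \<le> 0"
    if "\<beta> \<in> Xb" for \<beta>
  proof -
    have "(\<alpha>0, \<beta>0) \<in> ?S" "(\<alpha>0, \<beta>) \<in> ?S" using that D \<theta>0 by auto
    from Taylor_lower_bound_b[OF f(2) open_convex(2,1) this A3b A2b Cb third_b st(2)]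
    show ?thesis by simp
  qed
  have "\<mu>b / 2 * (norm (b - \<beta>0))\<^sup>2 - t * Z * norm (b - \<beta>0) - \<rho>2b / 2 * (norm (b - \<beta>0))\<^sup>2
           - Z / 6 * norm (b - \<beta>0) ^ 3 - t\<^sup>2 * (f (\<alpha>0, b) - f (\<alpha>0, \<beta>0)) \<le> 0"
    by (rule le_on_dense_subset[OF _ Xb' dense_b ab(2)]) (intro continuous_intros cont)
  then show "\<mu>b / 2 * (norm (b - \<beta>0))\<^sup>2 - t * Z * norm (b - \<beta>0) - \<rho>2b / 2 * (norm (b - \<beta>0))\<^sup>2
           - Z / 6 * norm (b - \<beta>0) ^ 3 \<le> t\<^sup>2 * (f (\<alpha>0, b) - f (\<alpha>0, \<beta>0))" by simp
qed

text \<open>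
  \<open>nn_integral\<close> of a non-measurable function is a lower integral, so a moment bound on an uncountable
  supremum says nothing about its exceedance probabilities. Hence the restriction to countable dense
  sets, and the completion, for which the derivatives, defined only almost surely, are measurable.
\<close>

lemma moments_bounded_envelope_completion:
  fixes X :: "nat \<Rightarrow> 'w \<Rightarrow> 'x \<Rightarrow> 'v::real_normed_vector"
  assumes X: "moments_bounded P S X" and D: "countable D" "D \<subseteq> S"
    and meas: "\<And>n x. x \<in> D \<Longrightarrow> (\<lambda>\<omega>. norm (X n \<omega> x)) \<in> borel_measurable (completion P)"
  shows "\<exists>Z. bounded_moments (completion P) Z \<and> (\<forall>n. AE \<omega> in P. \<forall>x\<in>D. norm (X n \<omega> x) \<le> Z n \<omega>)"
proof -
  obtain Z where "bounded_moments (completion P) Z"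
    "\<And>n. AE \<omega> in completion P. \<forall>x\<in>D. norm (X n \<omega> x) \<le> Z n \<omega>"
    using moments_bounded_envelope[OF iffD2[OF moments_bounded_completion X] D meas] by blast
  then show ?thesis by (auto simp: AE_completion_iff)
qed

section \<open>From the moment assumptions to the estimator\<close>

theorem theorem3p20:
  fixes P :: "'w measure"
    and Q :: "'z measure"
    and \<Theta>a :: "(real ^ ('po::finite + 'ps::finite)) set"
    and \<Theta>b :: "(real ^ ('qo::finite + 'qs::finite)) set"
    and \<Theta> :: "((real ^ ('po + 'ps)) \<times> (real ^ ('qo + 'qs))) set"
    and \<alpha>0 :: "real ^ ('po + 'ps)"
    and \<beta>0 :: "real ^ ('qo + 'qs)"
    and s t :: "nat \<Rightarrow> real"
    and M H :: "nat \<Rightarrow> 'w \<Rightarrow> (real ^ ('po + 'ps)) \<times> (real ^ ('qo + 'qs)) \<Rightarrow> real"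
    and Ra Rb :: "real \<Rightarrow> real"
    and lao :: "nat \<Rightarrow> 'w \<Rightarrow> 'po \<Rightarrow> real"
    and las :: "nat \<Rightarrow> 'w \<Rightarrow> 'ps \<Rightarrow> real"
    and lbo :: "nat \<Rightarrow> 'w \<Rightarrow> 'qo \<Rightarrow> real"
    and lbs :: "nat \<Rightarrow> 'w \<Rightarrow> 'qs \<Rightarrow> real"
    and \<alpha>hat :: "nat \<Rightarrow> 'w \<Rightarrow> real ^ ('po + 'ps)"
    and \<beta>hat :: "nat \<Rightarrow> 'w \<Rightarrow> real ^ ('qo + 'qs)"
    and u :: "nat \<Rightarrow> 'w \<Rightarrow> real ^ ('po + 'ps)"
    and v :: "nat \<Rightarrow> 'w \<Rightarrow> real ^ ('qo + 'qs)"
    and M0a :: "real ^ ('po + 'ps) \<Rightarrow> real"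
    and M0b :: "real ^ ('qo + 'qs) \<Rightarrow> real"
    and C0a :: "real ^ ('qo + 'qs) \<Rightarrow> real ^ ('po + 'ps) ^ ('po + 'ps)"
    and C0b :: "real ^ ('qo + 'qs) ^ ('qo + 'qs)"
    and \<delta>1a \<delta>1b \<chi>a \<chi>b \<delta>2a \<delta>2b \<nu>a \<nu>b :: real
    and w0 :: "'z \<Rightarrow> (real ^ ('po + 'ps)) \<times> (real ^ ('qo + 'qs))"
  assumes P: "prob_space P"
    \<comment> \<open>parameter space and true value\<close>
    and \<Theta>: "\<Theta> = \<Theta>a \<times> \<Theta>b" "open \<Theta>" "bounded \<Theta>" "convex \<Theta>"
    and \<theta>0: "(\<alpha>0, \<beta>0) \<in> \<Theta>"
    and \<alpha>0: "\<forall>i. \<alpha>0 $ Inl i = 0" "\<forall>j. \<alpha>0 $ Inr j \<noteq> 0"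
    and \<beta>0: "\<forall>i. \<beta>0 $ Inl i = 0" "\<forall>j. \<beta>0 $ Inr j \<noteq> 0"
    \<comment> \<open>rates\<close>
    and st_pos: "\<forall>n. 0 < s n" "\<forall>n. 0 < t n"
    and st_lim: "s \<longlonglongrightarrow> 0" "t \<longlonglongrightarrow> 0" "s \<in> o(t)"
    \<comment> \<open>contrast function\<close>
    and M_meas: "\<forall>n. \<forall>\<theta>\<in>closure \<Theta>. (\<lambda>\<omega>. M n \<omega> \<theta>) \<in> borel_measurable P"
    and M_smooth: "\<forall>n. AE \<omega> in P. continuous_on (closure \<Theta>) (M n \<omega>) \<and> Ck_on 3 \<Theta> (M n \<omega>)"
    \<comment> \<open>penalties\<close>
    and lao: "\<forall>n i. (\<lambda>\<omega>. lao n \<omega> i) \<in> borel_measurable P \<and> (AE \<omega> in P. 0 \<le> lao n \<omega> i)"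
    and las: "\<forall>n j. (\<lambda>\<omega>. las n \<omega> j) \<in> borel_measurable P \<and> (AE \<omega> in P. 0 \<le> las n \<omega> j)"
    and lbo: "\<forall>n i. (\<lambda>\<omega>. lbo n \<omega> i) \<in> borel_measurable P \<and> (AE \<omega> in P. 0 \<le> lbo n \<omega> i)"
    and lbs: "\<forall>n j. (\<lambda>\<omega>. lbs n \<omega> j) \<in> borel_measurable P \<and> (AE \<omega> in P. 0 \<le> lbs n \<omega> j)"
    and R_nonneg: "\<forall>x. 0 \<le> Ra x" "\<forall>x. 0 \<le> Rb x"
    and R_0: "Ra 0 = 0" "Rb 0 = 0"
    and R_lip: "\<forall>a0 b0 k. a0 \<noteq> 0 \<and> b0 \<noteq> 0 \<and> k > 0 \<longrightarrow>
        (\<exists>C>0. \<forall>a' b'. max \<bar>a'\<bar> \<bar>b'\<bar> \<le> k \<longrightarrow>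
           \<bar>Ra a' - Ra a0\<bar> + \<bar>Rb b' - Rb b0\<bar> \<le> C * (\<bar>a' - a0\<bar> + \<bar>b' - b0\<bar>))"
    \<comment> \<open>regularized estimator\<close>
    and H: "\<forall>n \<omega> \<alpha> \<beta>. H n \<omega> (\<alpha>, \<beta>) = M n \<omega> (\<alpha>, \<beta>)
              + penalty Ra (lao n \<omega>) (las n \<omega>) \<alpha> + penalty Rb (lbo n \<omega>) (lbs n \<omega>) \<beta>"
    and hat_meas: "\<forall>n. \<alpha>hat n \<in> borel_measurable P" "\<forall>n. \<beta>hat n \<in> borel_measurable P"
    and hat: "\<forall>n. AE \<omega> in P.
        is_arg_min (H n \<omega>) (\<lambda>\<theta>. \<theta> \<in> closure \<Theta>) (\<alpha>hat n \<omega>, \<beta>hat n \<omega>)"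
    \<comment> \<open>(1)\<close>
    and pos1: "\<delta>1a > 0" "\<delta>1b > 0" "\<chi>a > 0" "\<chi>b > 0"
    and A1a: "moments_bounded P \<Theta> (\<lambda>n \<omega> (\<alpha>, \<beta>).
        s n powr (- 2 * \<delta>1a) * ((s n)\<^sup>2 * (M n \<omega> (\<alpha>, \<beta>) - M n \<omega> (\<alpha>0, \<beta>)) - M0a \<alpha>))"
    and A1b: "moments_bounded P \<Theta>b (\<lambda>n \<omega> \<beta>.
        t n powr (- 2 * \<delta>1b) * ((t n)\<^sup>2 * (M n \<omega> (\<alpha>0, \<beta>) - M n \<omega> (\<alpha>0, \<beta>0)) - M0b \<beta>))"
    and A1c: "\<forall>\<alpha>\<in>\<Theta>a. M0a \<alpha> \<ge> \<chi>a * (norm (\<alpha> - \<alpha>0))\<^sup>2"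
    and A1d: "\<forall>\<beta>\<in>\<Theta>b. M0b \<beta> \<ge> \<chi>b * (norm (\<beta> - \<beta>0))\<^sup>2"
    \<comment> \<open>(2)\<close>
    and \<delta>2: "0 < \<delta>2a" "\<delta>2a \<le> 1/2" "0 < \<delta>2b" "\<delta>2b \<le> 1/2"
    and C0b: "positive_definite C0b"
    and C0a: "\<forall>\<beta>\<in>\<Theta>b. symmetric_matrix (C0a \<beta>)"
        "(INF \<beta>\<in>\<Theta>b. ereal (lambda_min (C0a \<beta>))) > 0"
    and A2a: "moments_bounded P \<Theta>b (\<lambda>n \<omega> \<beta>.
        s n powr (- 2 * \<delta>2a) *\<^sub>R ((s n)\<^sup>2 *\<^sub>R D_aa (M n \<omega>) (\<alpha>0, \<beta>) - C0a \<beta>))"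
    and A2b: "moments_bounded P {(\<alpha>0, \<beta>0)} (\<lambda>n \<omega> \<theta>.
        t n powr (- 2 * \<delta>2b) *\<^sub>R ((t n)\<^sup>2 *\<^sub>R D_bb (M n \<omega>) \<theta> - C0b))"
    and A2c: "moments_bounded P \<Theta>a (\<lambda>n \<omega> \<alpha>.
        (s n * t n powr (2 * (1 - \<delta>2b))) *\<^sub>R D_abb (M n \<omega>) (\<alpha>, \<beta>0))"
    \<comment> \<open>(3)\<close>
    and A3a: "moments_bounded P \<Theta>b (\<lambda>n \<omega> \<beta>. s n *\<^sub>R D_a (M n \<omega>) (\<alpha>0, \<beta>))"
    and A3b: "moments_bounded P {(\<alpha>0, \<beta>0)} (\<lambda>n \<omega> \<theta>. t n *\<^sub>R D_b (M n \<omega>) \<theta>)"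
    and A3c: "moments_bounded P \<Theta> (\<lambda>n \<omega> \<theta>. (s n)\<^sup>2 *\<^sub>R D_aaa (M n \<omega>) \<theta>)"
    and A3d: "moments_bounded P \<Theta> (\<lambda>n \<omega> \<theta>. (t n)\<^sup>2 *\<^sub>R D_bbb (M n \<omega>) \<theta>)"
    and A3e: "moments_bounded P \<Theta>a (\<lambda>n \<omega> \<alpha>. (s n * t n) *\<^sub>R D_ab (M n \<omega>) (\<alpha>, \<beta>0))"
    \<comment> \<open>(4)\<close>
    and \<nu>: "0 < \<nu>a" "\<nu>a < 1/2" "0 < \<nu>b" "\<nu>b < 1/2"
    and A4a: "moments_bounded P \<Theta>a (\<lambda>n \<omega> \<alpha>.
        s n powr (1 + 2 * \<nu>a) * penalty Ra (lao n \<omega>) (las n \<omega>) \<alpha>)"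
    and A4b: "moments_bounded P \<Theta>b (\<lambda>n \<omega> \<beta>.
        t n powr (1 + 2 * \<nu>b) * penalty Rb (lbo n \<omega>) (lbs n \<omega>) \<beta>)"
    and A4c: "\<forall>K>0. (SUP n. MAX j. \<integral>\<^sup>+\<omega>. ennreal (\<bar>s n * las n \<omega> j\<bar> powr K) \<partial>P) < \<infinity>"
    and A4d: "\<forall>K>0. (SUP n. MAX j. \<integral>\<^sup>+\<omega>. ennreal (\<bar>t n * lbs n \<omega> j\<bar> powr K) \<partial>P) < \<infinity>"
    \<comment> \<open>scaled estimation error\<close>
    and u: "\<forall>n \<omega>. u n \<omega> = (1 / s n) *\<^sub>R (\<alpha>hat n \<omega> - \<alpha>0)"
    and v: "\<forall>n \<omega>. v n \<omega> = (1 / t n) *\<^sub>R (\<beta>hat n \<omega> - \<beta>0)"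
  shows "(\<forall>L>0. (SUP r\<in>{0<..}. SUP n.
            ennreal (r powr L * measure P {\<omega> \<in> space P. norm (u n \<omega>, v n \<omega>) \<ge> r})) < \<infinity>)
       \<and> (prob_space Q \<and> w0 \<in> borel_measurable Q
            \<and> conv_in_law P (\<lambda>n \<omega>. (u n \<omega>, v n \<omega>)) Q w0 \<longrightarrow>
          (\<forall>f. continuous_on UNIV f \<and> poly_growth f \<longrightarrow>
             (\<forall>n. integrable P (\<lambda>\<omega>. f (u n \<omega>, v n \<omega>))) \<and> integrable Q (\<lambda>z. f (w0 z)) \<and>
             (\<lambda>n. \<integral>\<omega>. f (u n \<omega>, v n \<omega>) \<partial>P) \<longlonglongrightarrow> (\<integral>z. f (w0 z) \<partial>Q)))"
proof -
  interpret prob_space P by (rule P)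
  let ?P = "completion P"
  have P': "prob_space ?P"
    by (rule prob_spaceI) (simp add: emeasure_space_1)
  have cl: "closure \<Theta> = closure \<Theta>a \<times> closure \<Theta>b" by (simp add: \<Theta>(1) closure_Times)
  have base: "\<alpha>0 \<in> \<Theta>a" "\<beta>0 \<in> \<Theta>b" using \<theta>0 \<Theta>(1) by auto
  then have base_cl: "\<alpha>0 \<in> closure \<Theta>a" "\<beta>0 \<in> closure \<Theta>b"
    by (auto intro: subsetD[OF closure_subset])
  obtain Xa where Xa: "countable Xa" "Xa \<subseteq> \<Theta>a" "\<Theta>a \<subseteq> closure Xa" by (rule separable[of \<Theta>a])
  obtain Xb where Xb: "countable Xb" "Xb \<subseteq> \<Theta>b" "\<Theta>b \<subseteq> closure Xb" by (rule separable[of \<Theta>b])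
  have X: "countable (Xa \<times> Xb)" "Xa \<times> Xb \<subseteq> \<Theta>"
    using countable_SIGMA[OF Xa(1) Xb(1)] Sigma_mono[OF Xa(2) Xb(2)] by (simp_all only: \<Theta>(1))
  have in_cl: "(\<alpha>, \<beta>) \<in> closure \<Theta>" if "\<alpha> \<in> \<Theta>a" "\<beta> \<in> \<Theta>b" for \<alpha> \<beta>
    using that by (intro subsetD[OF closure_subset]) (simp add: \<Theta>(1))
  obtain k where k: "0 < k" "\<And>\<theta>. \<theta> \<in> closure \<Theta> \<Longrightarrow> norm \<theta> \<le> k"
    using bounded_closure[OF \<Theta>(3)] by (auto simp: bounded_pos)

  \<comment> \<open>\<open>R_lip\<close> bounds the two penalties jointly; setting the other
    argument and its base point both equal to 1 makes the other terms vanish. The radius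
    \<open>k + 1\<close> makes the value 1 admissible.\<close>
  have Ra: "\<exists>C>0. \<forall>a. \<bar>a\<bar> \<le> k + 1 \<longrightarrow> \<bar>Ra a - Ra a0\<bar> \<le> C * \<bar>a - a0\<bar>" if a0: "a0 \<noteq> 0" for a0
  proof -
    obtain C where C: "C > 0" "\<And>a' b'. max \<bar>a'\<bar> \<bar>b'\<bar> \<le> k + 1 \<Longrightarrow>
        \<bar>Ra a' - Ra a0\<bar> + \<bar>Rb b' - Rb 1\<bar> \<le> C * (\<bar>a' - a0\<bar> + \<bar>b' - 1\<bar>)"
      using R_lip[rule_format, of a0 1 "k + 1"] a0 k(1) by auto
    show ?thesis using C(1) C(2)[of _ 1] k(1) by (intro exI[of _ C]) auto
  qed
  have Rb: "\<exists>C>0. \<forall>b. \<bar>b\<bar> \<le> k + 1 \<longrightarrow> \<bar>Rb b - Rb b0\<bar> \<le> C * \<bar>b - b0\<bar>" if b0: "b0 \<noteq> 0" for b0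
  proof -
    obtain C where C: "C > 0" "\<And>a' b'. max \<bar>a'\<bar> \<bar>b'\<bar> \<le> k + 1 \<Longrightarrow>
        \<bar>Ra a' - Ra 1\<bar> + \<bar>Rb b' - Rb b0\<bar> \<le> C * (\<bar>a' - 1\<bar> + \<bar>b' - b0\<bar>)"
      using R_lip[rule_format, of 1 b0 "k + 1"] b0 k(1) by auto
    show ?thesis using C(1) C(2)[of 1] k(1) by (intro exI[of _ C]) auto
  qed
  obtain ca where ca: "0 \<le> ca"
    "\<And>j a. \<bar>a\<bar> \<le> k + 1 \<Longrightarrow> \<bar>Ra a - Ra (\<alpha>0 $ Inr j)\<bar> \<le> ca * \<bar>a - \<alpha>0 $ Inr j\<bar>"
    using uniform_lipschitz_at_nonzero[OF Ra, of \<alpha>0] \<alpha>0(2) by blast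
  obtain cb where cb: "0 \<le> cb"
    "\<And>j b. \<bar>b\<bar> \<le> k + 1 \<Longrightarrow> \<bar>Rb b - Rb (\<beta>0 $ Inr j)\<bar> \<le> cb * \<bar>b - \<beta>0 $ Inr j\<bar>"
    using uniform_lipschitz_at_nonzero[OF Rb, of \<beta>0] \<beta>0(2) by blast

  obtain \<mu>a where \<mu>a: "0 < \<mu>a" "\<And>\<beta> x. \<beta> \<in> \<Theta>b \<Longrightarrow> \<mu>a * (norm x)\<^sup>2 \<le> x \<bullet> (C0a \<beta> *v x)"
  proof -
    \<comment> \<open>Any real number strictly between 0 and the extended real infimum serves as a
      coercivity constant uniform in beta.\<close>
    obtain \<mu> where \<mu>: "0 < ereal \<mu>" "ereal \<mu> < (INF \<beta>\<in>\<Theta>b. ereal (lambda_min (C0a \<beta>)))"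
      using ereal_dense2[OF C0a(2)] by auto
    have "\<mu> * (norm x)\<^sup>2 \<le> x \<bullet> (C0a \<beta> *v x)" if "\<beta> \<in> \<Theta>b" for \<beta> x
    proof -
      have "ereal \<mu> < ereal (lambda_min (C0a \<beta>))" using less_INF_D[OF \<mu>(2) that] .
      then have "\<mu> * (norm x)\<^sup>2 \<le> lambda_min (C0a \<beta>) * (norm x)\<^sup>2" by (intro mult_right_mono) auto
      also have "\<dots> \<le> x \<bullet> (C0a \<beta> *v x)" using C0a(1) that by (intro lambda_min_le_quadratic_form) auto
      finally show ?thesis .
    qed
    with \<mu>(1) show ?thesis by (intro that[of \<mu>]) auto
  qed
  obtain \<mu>b where \<mu>b: "0 < \<mu>b" "\<And>x. \<mu>b * (norm x)\<^sup>2 \<le> x \<bullet> (C0b *v x)"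
    using positive_definite_coercive[OF C0b] by blast

  \<comment> \<open>Two points of norm at most \<open>k\<close> are at distance at most
    \<open>2 * k\<close>.\<close>
  define D where "D = 2 * k"
  have D: "0 \<le> D" using k(1) by (simp add: D_def)
  have "0 < \<mu>a / 2" "0 < \<mu>b / 2" using \<mu>a(1) \<mu>b(1) by auto
  from rescaled_error_bound[OF pos1(3) this(1) pos1(1) \<delta>2(1) D]
  obtain Ca ma where ma: "0 < Ca" "0 < ma"
    "\<And>s x Z. \<lbrakk>0 < s; 0 \<le> x; x \<le> D; 1 \<le> Z;
       \<chi>a * x\<^sup>2 \<le> s powr (2 * \<delta>1a) * Z + Z * (s\<^sup>2 + s * x);
       \<mu>a / 2 * x\<^sup>2 \<le> Z * (s\<^sup>2 + s * x) + s powr (2 * \<delta>2a) * Z * x\<^sup>2 + Z * x ^ 3\<rbrakk>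
     \<Longrightarrow> x / s \<le> Ca * Z powr ma" by blast
  from rescaled_error_bound[OF pos1(4) \<open>0 < \<mu>b / 2\<close> pos1(2) \<delta>2(3) D]
  obtain Cb mb where mb: "0 < Cb" "0 < mb"
    "\<And>s x Z. \<lbrakk>0 < s; 0 \<le> x; x \<le> D; 1 \<le> Z;
       \<chi>b * x\<^sup>2 \<le> s powr (2 * \<delta>1b) * Z + Z * (s\<^sup>2 + s * x);
       \<mu>b / 2 * x\<^sup>2 \<le> Z * (s\<^sup>2 + s * x) + s powr (2 * \<delta>2b) * Z * x\<^sup>2 + Z * x ^ 3\<rbrakk>
     \<Longrightarrow> x / s \<le> Cb * Z powr mb" by blast

  obtain E where E: "0 \<le> E" "\<And>n. s n powr (2 * \<delta>2a) \<le> E"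
  proof -
    obtain B where B: "0 < B" "\<And>n. norm (s n) \<le> B"
      using convergent_imp_Bseq[OF convergentI[OF st_lim(1)]] by (auto simp: Bseq_def)
    have "s n powr (2 * \<delta>2a) \<le> B powr (2 * \<delta>2a)" for n
      using st_pos(1) B(2)[of n] \<delta>2 by (intro powr_mono2) (auto simp: less_imp_le)
    then show ?thesis by (intro that[of "B powr (2 * \<delta>2a)"]) auto
  qed

  have M_meas': "(\<lambda>\<omega>. M n \<omega> \<theta>) \<in> borel_measurable ?P" if "\<theta> \<in> closure \<Theta>" for n \<theta>
    using M_meas that by (intro measurable_completion) auto
  have M_C3: "AE \<omega> in P. Ck_on 3 \<Theta> (M n \<omega>)" for n
    using M_smooth[rule_format, of n] by eventually_elim simp
  have M_meas'': "(\<lambda>\<omega>. M n \<omega> \<theta>) \<in> borel_measurable ?P" if "\<theta> \<in> \<Theta>" for n \<theta>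
    by (rule M_meas') (rule subsetD[OF closure_subset that])
  have derivs: "(\<lambda>\<omega>. D_a (M n \<omega>) \<theta>) \<in> borel_measurable ?P"
      "(\<lambda>\<omega>. D_b (M n \<omega>) \<theta>) \<in> borel_measurable ?P"
      "(\<lambda>\<omega>. D_aa (M n \<omega>) \<theta>) \<in> borel_measurable ?P"
      "(\<lambda>\<omega>. D_bb (M n \<omega>) \<theta>) \<in> borel_measurable ?P"
      "(\<lambda>\<omega>. D_aaa (M n \<omega>) \<theta>) \<in> borel_measurable ?P"
      "(\<lambda>\<omega>. D_bbb (M n \<omega>) \<theta>) \<in> borel_measurable ?P" if "\<theta> \<in> \<Theta>" for n \<theta>
    by (rule measurable_partial_derivatives[OF \<Theta>(2) that _ M_C3], erule M_meas'')+
  note meas_intros = measurable_compose[OF _ borel_measurable_norm] borel_measurable_scaleR borel_measurable_diff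
    borel_measurable_times borel_measurable_const

  have norm_meas: "(\<lambda>\<omega>. norm (b *\<^sub>R g \<omega>)) \<in> borel_measurable ?P"
      "(\<lambda>\<omega>. norm (a *\<^sub>R (b *\<^sub>R g \<omega> - c))) \<in> borel_measurable ?P"
    if [measurable]: "g \<in> borel_measurable ?P"
    for g :: "'w \<Rightarrow> 'v::{real_normed_vector, second_countable_topology}" and a b :: real and c
    by measurable
  have Xb_base: "(\<alpha>0, \<beta>) \<in> \<Theta>" if "\<beta> \<in> Xb" for \<beta> using that Xb(2) base \<Theta>(1) by auto
  have E1: "\<exists>Z. bounded_moments ?P Z \<and> (\<forall>n. AE \<omega> in P. \<forall>\<theta>\<in>Xa \<times> Xb. norm (case \<theta> of (\<alpha>, \<beta>) \<Rightarrow>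
      s n powr (- 2 * \<delta>1a) * ((s n)\<^sup>2 * (M n \<omega> (\<alpha>, \<beta>) - M n \<omega> (\<alpha>0, \<beta>)) - M0a \<alpha>)) \<le> Z n \<omega>)"
  proof (rule moments_bounded_envelope_completion[OF A1a X])
    fix n x assume "x \<in> Xa \<times> Xb"
    then have "(fst x, snd x) \<in> \<Theta>" "(\<alpha>0, snd x) \<in> \<Theta>" using X(2) Xb_base by auto
    then show "(\<lambda>\<omega>. norm (case x of (\<alpha>, \<beta>) \<Rightarrow>
      s n powr (- 2 * \<delta>1a) * ((s n)\<^sup>2 * (M n \<omega> (\<alpha>, \<beta>) - M n \<omega> (\<alpha>0, \<beta>)) - M0a \<alpha>))) \<in> borel_measurable ?P"
      unfolding case_prod_beta by (intro meas_intros M_meas'')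
  qed
  have E2: "\<exists>Z. bounded_moments ?P Z \<and> (\<forall>n. AE \<omega> in P. \<forall>\<beta>\<in>Xb. norm (
      t n powr (- 2 * \<delta>1b) * ((t n)\<^sup>2 * (M n \<omega> (\<alpha>0, \<beta>) - M n \<omega> (\<alpha>0, \<beta>0)) - M0b \<beta>)) \<le> Z n \<omega>)"
    by (rule moments_bounded_envelope_completion[OF A1b Xb(1,2)])
       (intro meas_intros M_meas'' \<theta>0 Xb_base)
  have E3: "\<exists>Z. bounded_moments ?P Z \<and> (\<forall>n. AE \<omega> in P. \<forall>\<beta>\<in>Xb. norm (
      s n powr (- 2 * \<delta>2a) *\<^sub>R ((s n)\<^sup>2 *\<^sub>R D_aa (M n \<omega>) (\<alpha>0, \<beta>) - C0a \<beta>)) \<le> Z n \<omega>)"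
    by (rule moments_bounded_envelope_completion[OF A2a Xb(1,2)])
       (rule norm_meas(2), rule derivs(3), erule Xb_base)
  have E4: "\<exists>Z. bounded_moments ?P Z \<and> (\<forall>n. AE \<omega> in P. \<forall>\<theta>\<in>{(\<alpha>0, \<beta>0)}. norm (
      t n powr (- 2 * \<delta>2b) *\<^sub>R ((t n)\<^sup>2 *\<^sub>R D_bb (M n \<omega>) \<theta> - C0b)) \<le> Z n \<omega>)"
    by (rule moments_bounded_envelope_completion[OF A2b])
       (simp, use \<theta>0 in simp, rule norm_meas(2), rule derivs(4), use \<theta>0 in simp)
  have E5: "\<exists>Z. bounded_moments ?P Z \<and> (\<forall>n. AE \<omega> in P. \<forall>\<beta>\<in>Xb.
      norm (s n *\<^sub>R D_a (M n \<omega>) (\<alpha>0, \<beta>)) \<le> Z n \<omega>)"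
    by (rule moments_bounded_envelope_completion[OF A3a Xb(1,2)])
       (rule norm_meas(1), rule derivs(1), erule Xb_base)
  have E6: "\<exists>Z. bounded_moments ?P Z \<and> (\<forall>n. AE \<omega> in P. \<forall>\<theta>\<in>{(\<alpha>0, \<beta>0)}.
      norm (t n *\<^sub>R D_b (M n \<omega>) \<theta>) \<le> Z n \<omega>)"
    by (rule moments_bounded_envelope_completion[OF A3b])
       (simp, use \<theta>0 in simp, rule norm_meas(1), rule derivs(2), use \<theta>0 in simp)
  have E7: "\<exists>Z. bounded_moments ?P Z \<and> (\<forall>n. AE \<omega> in P. \<forall>\<theta>\<in>Xa \<times> Xb.
      norm ((s n)\<^sup>2 *\<^sub>R D_aaa (M n \<omega>) \<theta>) \<le> Z n \<omega>)"
    by (rule moments_bounded_envelope_completion[OF A3c X])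
       (rule norm_meas(1), rule derivs(5), erule subsetD[OF X(2)])
  have E8: "\<exists>Z. bounded_moments ?P Z \<and> (\<forall>n. AE \<omega> in P. \<forall>\<theta>\<in>Xa \<times> Xb.
      norm ((t n)\<^sup>2 *\<^sub>R D_bbb (M n \<omega>) \<theta>) \<le> Z n \<omega>)"
    by (rule moments_bounded_envelope_completion[OF A3d X])
       (rule norm_meas(1), rule derivs(6), erule subsetD[OF X(2)])
  from E1 obtain Z1 where Z1: "bounded_moments ?P Z1" and e1: "\<And>n. AE \<omega> in P. \<forall>\<theta>\<in>Xa \<times> Xb. norm (case \<theta> of (\<alpha>, \<beta>) \<Rightarrow>
      s n powr (- 2 * \<delta>1a) * ((s n)\<^sup>2 * (M n \<omega> (\<alpha>, \<beta>) - M n \<omega> (\<alpha>0, \<beta>)) - M0a \<alpha>)) \<le> Z1 n \<omega>" by blast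
  from E2 obtain Z2 where Z2: "bounded_moments ?P Z2" and e2: "\<And>n. AE \<omega> in P. \<forall>\<beta>\<in>Xb. norm (
      t n powr (- 2 * \<delta>1b) * ((t n)\<^sup>2 * (M n \<omega> (\<alpha>0, \<beta>) - M n \<omega> (\<alpha>0, \<beta>0)) - M0b \<beta>)) \<le> Z2 n \<omega>" by blast
  from E3 obtain Z3 where Z3: "bounded_moments ?P Z3" and e3: "\<And>n. AE \<omega> in P. \<forall>\<beta>\<in>Xb. norm (
      s n powr (- 2 * \<delta>2a) *\<^sub>R ((s n)\<^sup>2 *\<^sub>R D_aa (M n \<omega>) (\<alpha>0, \<beta>) - C0a \<beta>)) \<le> Z3 n \<omega>" by blast
  from E4 obtain Z4 where Z4: "bounded_moments ?P Z4" and e4: "\<And>n. AE \<omega> in P. norm (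
      t n powr (- 2 * \<delta>2b) *\<^sub>R ((t n)\<^sup>2 *\<^sub>R D_bb (M n \<omega>) (\<alpha>0, \<beta>0) - C0b)) \<le> Z4 n \<omega>" by auto
  from E5 obtain Z5 where Z5: "bounded_moments ?P Z5" and e5: "\<And>n. AE \<omega> in P. \<forall>\<beta>\<in>Xb.
      norm (s n *\<^sub>R D_a (M n \<omega>) (\<alpha>0, \<beta>)) \<le> Z5 n \<omega>" by blast
  from E6 obtain Z6 where Z6: "bounded_moments ?P Z6" and e6: "\<And>n. AE \<omega> in P.
      norm (t n *\<^sub>R D_b (M n \<omega>) (\<alpha>0, \<beta>0)) \<le> Z6 n \<omega>" by auto
  from E7 obtain Z7 where Z7: "bounded_moments ?P Z7" and e7: "\<And>n. AE \<omega> in P. \<forall>\<theta>\<in>Xa \<times> Xb.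
      norm ((s n)\<^sup>2 *\<^sub>R D_aaa (M n \<omega>) \<theta>) \<le> Z7 n \<omega>" by blast
  from E8 obtain Z8 where Z8: "bounded_moments ?P Z8" and e8: "\<And>n. AE \<omega> in P. \<forall>\<theta>\<in>Xa \<times> Xb.
      norm ((t n)\<^sup>2 *\<^sub>R D_bbb (M n \<omega>) \<theta>) \<le> Z8 n \<omega>" by blast
  \<comment> \<open>These dominate the decrease of the penalties, with \<open>ca\<close> and
    \<open>cb\<close> the Lipschitz constants. The absolute values secure nonnegativity everywhere,
    since the weights are nonnegative only almost surely.\<close>
  define Z9 where "Z9 = (\<lambda>n \<omega>. ca * (\<Sum>j\<in>UNIV. \<bar>s n * las n \<omega> j\<bar>))"
  define Z10 where "Z10 = (\<lambda>n \<omega>. cb * (\<Sum>j\<in>UNIV. \<bar>t n * lbs n \<omega> j\<bar>))"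
  have Z9: "bounded_moments ?P Z9"
    unfolding Z9_def using A4c las ca(1)
    by (intro bounded_moments_cmult bounded_moments_MAX P')
       (auto intro!: measurable_completion borel_measurable_times simp: nn_integral_completion)
  have Z10: "bounded_moments ?P Z10"
    unfolding Z10_def using A4d lbs cb(1)
    by (intro bounded_moments_cmult bounded_moments_MAX P')
       (auto intro!: measurable_completion borel_measurable_times simp: nn_integral_completion)
  \<comment> \<open>One variable dominates all ten bounds; the summand 1 provides
    \<open>1 \<le> Z\<close>, which the rate inequality requires.\<close>
  define Z where "Z = (\<lambda>n \<omega>. 1 + (Z1 n \<omega> + (Z2 n \<omega> + (Z3 n \<omega> + (Z4 n \<omega> + (Z5 n \<omega> + (Z6 n \<omega>
    + (Z7 n \<omega> + (Z8 n \<omega> + (Z9 n \<omega> + Z10 n \<omega>))))))))))"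
  have Z: "bounded_moments ?P Z"
    unfolding Z_def
    by (intro bounded_moments_add bounded_moments_const P' Z1 Z2 Z3 Z4 Z5 Z6 Z7 Z8 Z9 Z10) simp
  note Z_nonneg = bounded_momentsD(2)[OF Z1] bounded_momentsD(2)[OF Z2] bounded_momentsD(2)[OF Z3]
    bounded_momentsD(2)[OF Z4] bounded_momentsD(2)[OF Z5] bounded_momentsD(2)[OF Z6]
    bounded_momentsD(2)[OF Z7] bounded_momentsD(2)[OF Z8] bounded_momentsD(2)[OF Z9]
    bounded_momentsD(2)[OF Z10]
  have Z_ge: "1 \<le> Z n \<omega>" "Z1 n \<omega> \<le> Z n \<omega>" "Z2 n \<omega> \<le> Z n \<omega>" "Z3 n \<omega> \<le> Z n \<omega>" "Z4 n \<omega> \<le> Z n \<omega>"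
    "Z5 n \<omega> \<le> Z n \<omega>" "Z6 n \<omega> \<le> Z n \<omega>" "Z7 n \<omega> \<le> Z n \<omega>" "Z8 n \<omega> \<le> Z n \<omega>" "Z9 n \<omega> \<le> Z n \<omega>"
    "Z10 n \<omega> \<le> Z n \<omega>" for n \<omega>
    using Z_nonneg[of n \<omega>] unfolding Z_def by linarith+
  have scaled: "norm y \<le> r powr (2 * \<delta>) * W" if "norm (r powr (- 2 * \<delta>) *\<^sub>R y) \<le> W'" "W' \<le> W" "0 < r"
    for y :: "'v::real_normed_vector" and r \<delta> W W' :: real
  proof -
    have "r powr (2 * \<delta>) * (r powr (- 2 * \<delta>) * norm y) \<le> r powr (2 * \<delta>) * W"
      using that by (intro mult_left_mono) auto
    then show ?thesis using that(3) by (simp add: mult.assoc[symmetric] powr_add[symmetric])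
  qed

  \<comment> \<open>Random versions of the bounds in \<open>two_step_error_bound\<close>. They arise
    from \<open>Z\<close> by sums, products and positive powers with nonrandom coefficients, so
    their moments stay bounded.\<close>
  define U where "U = (\<lambda>n \<omega>. Ca * (2 * Z n \<omega>) powr ma)"
  define Z' where "Z' = (\<lambda>n \<omega>. Z n \<omega> + 2 * (Z n \<omega> * U n \<omega>) + (E + D) * (Z n \<omega> * (U n \<omega> * U n \<omega>)))"
  define V where "V = (\<lambda>n \<omega>. U n \<omega> + Cb * (2 * Z' n \<omega>) powr mb)"
  have U: "bounded_moments ?P U"
    unfolding U_def using ma Z by (intro bounded_moments_cmult bounded_moments_powr) auto
  have Z': "bounded_moments ?P Z'"
    unfolding Z'_def using Z U E(1) D by (intro bounded_moments_cmult bounded_moments_add bounded_moments_mult) auto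
  have V: "bounded_moments ?P V"
    unfolding V_def using mb Z' U by (intro bounded_moments_add bounded_moments_cmult bounded_moments_powr) auto

  have bound: "AE \<omega> in P. norm (u n \<omega>, v n \<omega>) \<le> V n \<omega>" for n
  proof -
    have sn: "0 < s n" "0 < t n" using st_pos by auto
    have "AE \<omega> in P. \<forall>i. 0 \<le> lao n \<omega> i" "AE \<omega> in P. \<forall>i. 0 \<le> las n \<omega> i"
      "AE \<omega> in P. \<forall>i. 0 \<le> lbo n \<omega> i" "AE \<omega> in P. \<forall>i. 0 \<le> lbs n \<omega> i"
      using lao las lbo lbs by (simp_all add: AE_all_countable)
    then show ?thesis
      using M_smooth[rule_format, of n] hat[rule_format, of n]
        e1[of n] e2[of n] e3[of n] e4[of n] e5[of n] e6[of n] e7[of n] e8[of n]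
    proof eventually_elim
      case (elim \<omega>)
      note lam = elim(1-4) and smooth = elim(5) and arg_min = elim(6) and e = elim(7-14)
      let ?a = "\<alpha>hat n \<omega>" and ?b = "\<beta>hat n \<omega>" and ?f = "M n \<omega>" and ?Z = "Z n \<omega>"
      have ab: "(?a, ?b) \<in> closure \<Theta>" and
        le: "H n \<omega> (?a, ?b) \<le> H n \<omega> (\<alpha>0, ?b)" "H n \<omega> (?a, ?b) \<le> H n \<omega> (\<alpha>0, \<beta>0)"
        using arg_min base_cl by (auto simp: is_arg_min_def cl not_less)
      have ab': "?a \<in> closure \<Theta>a" "?b \<in> closure \<Theta>b" using ab by (auto simp: cl)
      have norm_ab: "norm ?a \<le> k" "norm ?b \<le> k" "norm \<alpha>0 \<le> k" "norm \<beta>0 \<le> k"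
        using k(2)[OF ab] k(2)[OF in_cl[OF base]] norm_fst_le[of ?a ?b] norm_snd_le[of ?b ?a]
          norm_fst_le[of \<alpha>0 \<beta>0] norm_snd_le[of \<beta>0 \<alpha>0] by linarith+
      have xD: "norm (?a - \<alpha>0) \<le> D" "norm (?b - \<beta>0) \<le> D"
        using norm_ab norm_triangle_ineq4[of ?a \<alpha>0] norm_triangle_ineq4[of ?b \<beta>0]
        unfolding D_def by linarith+
      have pen_a: "penalty Ra (lao n \<omega>) (las n \<omega>) \<alpha>0 - penalty Ra (lao n \<omega>) (las n \<omega>) ?a
          \<le> ?Z * (norm (?a - \<alpha>0) / s n)"
      proof -
        have "\<bar>?a $ Inr j\<bar> \<le> k + 1" for j
          using component_le_norm_cart[of ?a "Inr j"] norm_ab(1) by linarith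
        then have "penalty Ra (lao n \<omega>) (las n \<omega>) \<alpha>0 - penalty Ra (lao n \<omega>) (las n \<omega>) ?a
          \<le> ca * (\<Sum>j\<in>UNIV. las n \<omega> j) * norm (?a - \<alpha>0)"
          using R_nonneg(1) R_0(1) lam \<alpha>0(1) ca by (intro penalty_difference) auto
        \<comment> \<open>The moment assumption concerns \<open>s n * las n \<omega> j\<close>; the
          compensating division by \<open>s n\<close> turns the distance into the rescaled
          error.\<close>
        also have "\<dots> = Z9 n \<omega> * (norm (?a - \<alpha>0) / s n)"
          using sn lam(2) by (simp add: Z9_def abs_mult sum_distrib_left[symmetric])
        also have "\<dots> \<le> ?Z * (norm (?a - \<alpha>0) / s n)"
          using Z_ge(10) sn by (intro mult_right_mono) auto
        finally show ?thesis .
      qed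
      have pen_b: "penalty Rb (lbo n \<omega>) (lbs n \<omega>) \<beta>0 - penalty Rb (lbo n \<omega>) (lbs n \<omega>) ?b
          \<le> ?Z * (norm (?b - \<beta>0) / t n)"
      proof -
        have "\<bar>?b $ Inr j\<bar> \<le> k + 1" for j
          using component_le_norm_cart[of ?b "Inr j"] norm_ab(2) by linarith
        then have "penalty Rb (lbo n \<omega>) (lbs n \<omega>) \<beta>0 - penalty Rb (lbo n \<omega>) (lbs n \<omega>) ?b
          \<le> cb * (\<Sum>j\<in>UNIV. lbs n \<omega> j) * norm (?b - \<beta>0)"
          using R_nonneg(2) R_0(2) lam \<beta>0(1) cb by (intro penalty_difference) auto
        also have "\<dots> = Z10 n \<omega> * (norm (?b - \<beta>0) / t n)"
          using sn lam(4) by (simp add: Z10_def abs_mult sum_distrib_left[symmetric])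
        also have "\<dots> \<le> ?Z * (norm (?b - \<beta>0) / t n)"
          using Z_ge(11) sn by (intro mult_right_mono) auto
        finally show ?thesis .
      qed
      have 1: "\<chi>a * (norm (\<alpha> - \<alpha>0))\<^sup>2 - s n powr (2 * \<delta>1a) * ?Z
          \<le> (s n)\<^sup>2 * (?f (\<alpha>, \<beta>) - ?f (\<alpha>0, \<beta>))" if "\<alpha> \<in> Xa" "\<beta> \<in> Xb" for \<alpha> \<beta>
      proof -
        have "norm ((s n)\<^sup>2 * (?f (\<alpha>, \<beta>) - ?f (\<alpha>0, \<beta>)) - M0a \<alpha>) \<le> s n powr (2 * \<delta>1a) * ?Z"
          using e(1)[THEN bspec, of "(\<alpha>, \<beta>)"] that
          by (intro scaled[OF _ Z_ge(2) sn(1)]) simp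
        moreover have "\<chi>a * (norm (\<alpha> - \<alpha>0))\<^sup>2 \<le> M0a \<alpha>" using A1c that Xa(2) by blast
        ultimately show ?thesis by (simp add: abs_le_iff)
      qed
      have 2: "\<chi>b * (norm (\<beta> - \<beta>0))\<^sup>2 - t n powr (2 * \<delta>1b) * ?Z
          \<le> (t n)\<^sup>2 * (?f (\<alpha>0, \<beta>) - ?f (\<alpha>0, \<beta>0))" if "\<beta> \<in> Xb" for \<beta>
      proof -
        have "norm ((t n)\<^sup>2 * (?f (\<alpha>0, \<beta>) - ?f (\<alpha>0, \<beta>0)) - M0b \<beta>) \<le> t n powr (2 * \<delta>1b) * ?Z"
          using e(2)[THEN bspec, of \<beta>] that
          by (intro scaled[OF _ Z_ge(3) sn(2)]) simp
        moreover have "\<chi>b * (norm (\<beta> - \<beta>0))\<^sup>2 \<le> M0b \<beta>" using A1d that Xb(2) by blast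
        ultimately show ?thesis by (simp add: abs_le_iff)
      qed
      have 3: "norm ((s n)\<^sup>2 *\<^sub>R D_aa ?f (\<alpha>0, \<beta>) - C0a \<beta>) \<le> s n powr (2 * \<delta>2a) * ?Z" if "\<beta> \<in> Xb" for \<beta>
        using scaled[OF e(3)[THEN bspec, OF that] Z_ge(4) sn(1)] .
      have 4: "norm ((t n)\<^sup>2 *\<^sub>R D_bb ?f (\<alpha>0, \<beta>0) - C0b) \<le> t n powr (2 * \<delta>2b) * ?Z"
        using scaled[OF e(4) Z_ge(5) sn(2)] .
      have 5: "norm (s n *\<^sub>R D_a ?f (\<alpha>0, \<beta>)) \<le> ?Z" if "\<beta> \<in> Xb" for \<beta>
        using e(5)[THEN bspec, OF that] Z_ge(6) by (rule order_trans)
      have 6: "norm (t n *\<^sub>R D_b ?f (\<alpha>0, \<beta>0)) \<le> ?Z"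
        using e(6) Z_ge(7) by (rule order_trans)
      have 7: "norm ((s n)\<^sup>2 *\<^sub>R D_aaa ?f \<theta>) \<le> ?Z" if "\<theta> \<in> Xa \<times> Xb" for \<theta>
        using e(7)[THEN bspec, OF that] Z_ge(8) by (rule order_trans)
      have 8: "norm ((t n)\<^sup>2 *\<^sub>R D_bbb ?f \<theta>) \<le> ?Z" if "\<theta> \<in> Xa \<times> Xb" for \<theta>
        using e(8)[THEN bspec, OF that] Z_ge(9) by (rule order_trans)
      have Ca: "\<mu>a * (norm x)\<^sup>2 \<le> x \<bullet> (C0a \<beta> *v x)" if "\<beta> \<in> Xb" for \<beta> x
        using \<mu>a(2) that Xb(2) by blast
      note lower = contrast_lower_bounds[OF \<Theta>(2,4)[unfolded \<Theta>(1)] base Xa(2,3) Xb(2,3)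
          smooth[THEN conjunct1, unfolded \<Theta>(1)] smooth[THEN conjunct2, unfolded \<Theta>(1)] sn
          1 2 3 4 Ca \<mu>b(2) 5 6 7 8 ab']
      have "norm (?a - \<alpha>0) / s n + norm (?b - \<beta>0) / t n \<le> V n \<omega>"
        unfolding V_def Z'_def U_def
      proof (rule two_step_error_bound[OF ma(3) mb(3) sn(1) E(2) sn(2) norm_ge_zero xD(1)
            norm_ge_zero xD(2) Z_ge(1) \<mu>a(1) less_imp_le[OF ma(1)] lower])
        show "?f (?a, ?b) - ?f (\<alpha>0, ?b) \<le> ?Z * (norm (?a - \<alpha>0) / s n)"
          using le(1) pen_a by (simp add: H)
        show "?f (?a, ?b) - ?f (\<alpha>0, ?b) + (?f (\<alpha>0, ?b) - ?f (\<alpha>0, \<beta>0))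
            \<le> ?Z * (norm (?a - \<alpha>0) / s n) + ?Z * (norm (?b - \<beta>0) / t n)"
          using le(2) pen_a pen_b by (simp add: H)
      qed
      moreover have "norm (u n \<omega>, v n \<omega>) \<le> norm (?a - \<alpha>0) / s n + norm (?b - \<beta>0) / t n"
        using norm_Pair_le[of "u n \<omega>" "v n \<omega>"] sn u v by simp
      ultimately show ?case by linarith
    qed
  qed

  have W_meas: "(\<lambda>\<omega>. (u n \<omega>, v n \<omega>)) \<in> borel_measurable P" for n
  proof -
    have "u n = (\<lambda>\<omega>. (1 / s n) *\<^sub>R (\<alpha>hat n \<omega> - \<alpha>0))" "v n = (\<lambda>\<omega>. (1 / t n) *\<^sub>R (\<beta>hat n \<omega> - \<beta>0))"
      using u v by auto
    then show ?thesis using hat_meas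
      by (intro borel_measurable_Pair) (auto intro!: borel_measurable_scaleR borel_measurable_diff)
  qed
  have W: "bounded_moments P (\<lambda>n \<omega>. norm (u n \<omega>, v n \<omega>))"
    using W_meas by (intro bounded_moments_completion[OF V _ _ bound] measurable_compose[OF _ borel_measurable_norm]) auto
  show ?thesis
    using bounded_moments_tail[OF P W_meas W] convergence_of_moments[OF P W_meas W] by blast
qed

end
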